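(* Let $\Omega\subset\mathbb{R}^3$ be a bounded domain which supports the Hardy inequality with finite constant $H_\Omega$ and the second Friedrichs-Velte inequality with finite constant $\tilde\Gamma_\Omega$. Then there is a finite positive constant $\tilde P$ depending only on $\Omega$ such that $$\|v\|^2\le\tilde P\,\|d_\Omega\,\mathrm{rot}\,v\|^2$$ for every $v$ in the orthogonal complement of the kernel of $\mathrm{rot}$ in $L_2(\Omega)^3$. Moreover, the least possible constant $\tilde P_\Omega$ in this inequality satisfies $$\tilde P_\Omega\le H_\Omega\,(1+\tilde\Gamma_\Omega).$$
   Context: Functions are real-valued, $\|\cdot\|$ is the $L_2(\Omega)$ norm (of scalar or vector functions), $d_\Omega(x)=\mathrm{dist}(x,\partial\Omega)$, and $\mathrm{rot}$ is the curl in $\mathbb{R}^3$. Derivatives are in the distributional sense; the kernel of $\mathrm{rot}$ in $L_2(\Omega)^3$ is $\{w\in L_2(\Omega)^3:\mathrm{rot}\,w=0\}$. The right-hand side $\|d_\Omega\,\mathrm{rot}\,v\|$ is $+\infty$ if $d_\Omega\,\mathrm{rot}\,v\notin L_2(\Omega)^3$. Hardy inequality: $\int_\Omega \frac{|u|^2}{d_\Omega^2}\le H\int_\Omega|\nabla u|^2$ for every $u\in H_0^1(\Omega)^3$; $H_\Omega$ is the least such constant $H$. Second Friedrichs-Velte inequality: $\|v\|^2\le\tilde\Gamma\|u\|^2$ for every $u\in L_2(\Omega)$ and $v\in L_2(\Omega)^3$ satisfying $\mathrm{rot}\,v=\nabla u$ and $\mathrm{div}\,v=0$ in $\Omega$,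 with $v$ in the orthogonal complement of the kernel of $\mathrm{rot}$ in $L_2(\Omega)^3$; $\tilde\Gamma_\Omega$ is the least such constant $\tilde\Gamma$. *)

theory Defs
  imports "HOL-Analysis.Analysis"
begin

type_synonym point = "real ^ 3"

definition bounded_domain :: "point set \<Rightarrow> bool" where
  "bounded_domain \<Omega> \<longleftrightarrow> open \<Omega> \<and> connected \<Omega> \<and> \<Omega> \<noteq> {} \<and> bounded \<Omega>"

definition bdist :: "point set \<Rightarrow> point \<Rightarrow> real" where
  "bdist \<Omega> x = infdist x (frontier \<Omega>)"


section \<open>Square integrable functions\<close>

text \<open>Functions are total on the whole space; only their values on \<open>\<Omega>\<close> matter.
  The squared norm takes values in \<open>[0, \<infinity>]\<close>. On \<open>real^3^3\<close> the library norm is the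
  Frobenius norm, so the same definition covers Jacobian matrices.\<close>

definition l2_normsq :: "point set \<Rightarrow> (point \<Rightarrow> 'b::euclidean_space) \<Rightarrow> ennreal" where
  "l2_normsq \<Omega> f = (\<integral>\<^sup>+ x. ennreal ((norm (f x))\<^sup>2) \<partial>lebesgue_on \<Omega>)"

definition L2 :: "point set \<Rightarrow> (point \<Rightarrow> 'b::euclidean_space) set" where
  "L2 \<Omega> = {f. f \<in> borel_measurable (lebesgue_on \<Omega>) \<and> l2_normsq \<Omega> f < \<infinity>}"

definition l2_inner ::
    "point set \<Rightarrow> (point \<Rightarrow> 'b::euclidean_space) \<Rightarrow> (point \<Rightarrow> 'b) \<Rightarrow> real" where
  "l2_inner \<Omega> f g = (\<integral>x. f x \<bullet> g x \<partial>lebesgue_on \<Omega>)"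

definition locally_integrable :: "point set \<Rightarrow> (point \<Rightarrow> 'b::euclidean_space) \<Rightarrow> bool" where
  "locally_integrable \<Omega> f \<longleftrightarrow> (\<forall>K. compact K \<and> K \<subseteq> \<Omega> \<longrightarrow> integrable (lebesgue_on K) f)"


section \<open>Test functions\<close>

definition pderiv_at :: "3 \<Rightarrow> (point \<Rightarrow> 'b::euclidean_space) \<Rightarrow> point \<Rightarrow> 'b" where
  "pderiv_at i f x = frechet_derivative f (at x) (axis i 1)"

text \<open>\<open>C\<^sup>\<infinity>\<close>: all iterated partial derivatives, indexed by lists of
  coordinate directions, exist and are differentiable everywhere (hence continuous).\<close>

definition smooth :: "(point \<Rightarrow> 'b::euclidean_space) \<Rightarrow> bool" where
  "smooth f \<longleftrightarrow> (\<forall>is. foldr pderiv_at is f differentiable_on UNIV)"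

definition test_functions :: "point set \<Rightarrow> (point \<Rightarrow> 'b::euclidean_space) set" where
  "test_functions \<Omega> =
     {\<phi>. smooth \<phi> \<and> compact (closure {x. \<phi> x \<noteq> 0}) \<and> closure {x. \<phi> x \<noteq> 0} \<subseteq> \<Omega>}"


section \<open>Distributions and their derivatives\<close>

text \<open>A (scalar or vector valued) distribution is represented by its values on scalar test
  functions; two distributions on \<open>\<Omega>\<close> are equal if they agree on \<open>test_functions \<Omega>\<close>.\<close>

definition distr :: "point set \<Rightarrow> (point \<Rightarrow> 'b::euclidean_space) \<Rightarrow> (point \<Rightarrow> real) \<Rightarrow> 'b" where
  "distr \<Omega> f \<phi> = (\<integral>x. \<phi> x *\<^sub>R f x \<partial>lebesgue_on \<Omega>)"

definition distr_eq ::
    "point set \<Rightarrow> ((point \<Rightarrow> real) \<Rightarrow> 'b::euclidean_space) \<Rightarrow> ((point \<Rightarrow> real) \<Rightarrow> 'b) \<Rightarrow> bool" where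
  "distr_eq \<Omega> S T \<longleftrightarrow> (\<forall>\<phi>\<in>test_functions \<Omega>. S \<phi> = T \<phi>)"

definition distr_pderiv ::
    "3 \<Rightarrow> ((point \<Rightarrow> real) \<Rightarrow> 'b::euclidean_space) \<Rightarrow> (point \<Rightarrow> real) \<Rightarrow> 'b" where
  "distr_pderiv i T \<phi> = - T (pderiv_at i \<phi>)"

definition distr_grad :: "((point \<Rightarrow> real) \<Rightarrow> real) \<Rightarrow> (point \<Rightarrow> real) \<Rightarrow> real ^ 3" where
  "distr_grad T \<phi> = (\<chi> i. distr_pderiv i T \<phi>)"

definition distr_div :: "((point \<Rightarrow> real) \<Rightarrow> real ^ 3) \<Rightarrow> (point \<Rightarrow> real) \<Rightarrow> real" where
  "distr_div T \<phi> = (\<Sum>i\<in>UNIV. distr_pderiv i T \<phi> $ i)"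

definition distr_rot :: "((point \<Rightarrow> real) \<Rightarrow> real ^ 3) \<Rightarrow> (point \<Rightarrow> real) \<Rightarrow> real ^ 3" where
  "distr_rot T \<phi> = vector
     [distr_pderiv 2 T \<phi> $ 3 - distr_pderiv 3 T \<phi> $ 2,
      distr_pderiv 3 T \<phi> $ 1 - distr_pderiv 1 T \<phi> $ 3,
      distr_pderiv 1 T \<phi> $ 2 - distr_pderiv 2 T \<phi> $ 1]"

text \<open>Row \<open>j\<close>, column \<open>i\<close> of a gradient of a vector field \<open>u\<close> is \<open>\<partial>\<^sub>i u\<^sub>j\<close>,
  as in \<^const>\<open>jacobian\<close>.\<close>

definition distr_jacobian :: "((point \<Rightarrow> real) \<Rightarrow> real ^ 3) \<Rightarrow> (point \<Rightarrow> real) \<Rightarrow> real ^ 3 ^ 3" where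
  "distr_jacobian T \<phi> = (\<chi> j i. distr_pderiv i T \<phi> $ j)"


section \<open>The Hardy inequality\<close>

definition has_L2_gradient ::
    "point set \<Rightarrow> (point \<Rightarrow> real ^ 3) \<Rightarrow> (point \<Rightarrow> real ^ 3 ^ 3) \<Rightarrow> bool" where
  "has_L2_gradient \<Omega> u G \<longleftrightarrow>
     G \<in> L2 \<Omega> \<and> distr_eq \<Omega> (distr_jacobian (distr \<Omega> u)) (distr \<Omega> G)"

text \<open>\<open>H\<^sub>0\<^sup>1(\<Omega>)\<^sup>3\<close>: the closure of the test fields in the norm of \<open>H\<^sup>1(\<Omega>)\<^sup>3\<close>.\<close>

definition H10 :: "point set \<Rightarrow> (point \<Rightarrow> real ^ 3) set" where
  "H10 \<Omega> = {u \<in> L2 \<Omega>. \<exists>G. has_L2_gradient \<Omega> u G \<and>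
     (\<exists>\<Phi>::nat \<Rightarrow> point \<Rightarrow> real ^ 3.
        (\<forall>n. \<Phi> n \<in> test_functions \<Omega>) \<and>
        (\<lambda>n. l2_normsq \<Omega> (\<lambda>x. \<Phi> n x - u x)) \<longlonglongrightarrow> 0 \<and>
        (\<lambda>n. l2_normsq \<Omega> (\<lambda>x. jacobian (\<Phi> n) (at x) - G x)) \<longlonglongrightarrow> 0)}"

definition hardy_inequality :: "point set \<Rightarrow> real \<Rightarrow> bool" where
  "hardy_inequality \<Omega> H \<longleftrightarrow> 0 \<le> H \<and>
     (\<forall>u\<in>H10 \<Omega>. \<forall>G. has_L2_gradient \<Omega> u G \<longrightarrow>
        (\<integral>\<^sup>+ x. ennreal ((norm (u x))\<^sup>2 / (bdist \<Omega> x)\<^sup>2) \<partial>lebesgue_on \<Omega>)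
          \<le> ennreal H * l2_normsq \<Omega> G)"

definition hardy_constant :: "point set \<Rightarrow> real" where
  "hardy_constant \<Omega> = Inf {H. hardy_inequality \<Omega> H}"


section \<open>The second Friedrichs-Velte inequality\<close>

definition ker_rot :: "point set \<Rightarrow> (point \<Rightarrow> real ^ 3) set" where
  "ker_rot \<Omega> = {w \<in> L2 \<Omega>. distr_eq \<Omega> (distr_rot (distr \<Omega> w)) (\<lambda>_. 0)}"

definition ker_rot_perp :: "point set \<Rightarrow> (point \<Rightarrow> real ^ 3) set" where
  "ker_rot_perp \<Omega> = {v \<in> L2 \<Omega>. \<forall>w\<in>ker_rot \<Omega>. l2_inner \<Omega> v w = 0}"

definition friedrichs_velte2 :: "point set \<Rightarrow> real \<Rightarrow> bool" where
  "friedrichs_velte2 \<Omega> \<Gamma> \<longleftrightarrow> 0 \<le> \<Gamma> \<and>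
     (\<forall>u\<in>L2 \<Omega>. \<forall>v\<in>ker_rot_perp \<Omega>.
        distr_eq \<Omega> (distr_rot (distr \<Omega> v)) (distr_grad (distr \<Omega> u)) \<and>
        distr_eq \<Omega> (distr_div (distr \<Omega> v)) (\<lambda>_. 0) \<longrightarrow>
        l2_normsq \<Omega> v \<le> ennreal \<Gamma> * l2_normsq \<Omega> u)"

definition friedrichs_velte2_constant :: "point set \<Rightarrow> real" where
  "friedrichs_velte2_constant \<Omega> = Inf {\<Gamma>. friedrichs_velte2 \<Omega> \<Gamma>}"


section \<open>The weighted rot inequality\<close>

text \<open>The squared norm of \<open>d\<^sub>\<Omega> rot v\<close>. As \<open>d\<^sub>\<Omega>\<close> is locally bounded away from
  zero, \<open>d\<^sub>\<Omega> rot v\<close> can only be square integrable if the distribution \<open>rot v\<close> is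
  given by a locally integrable function \<open>w\<close>. Such a \<open>w\<close> is unique almost everywhere, so
  the infimum merely selects it, and it yields \<open>\<infinity>\<close> if there is none.\<close>

definition weighted_rot_normsq :: "point set \<Rightarrow> (point \<Rightarrow> real ^ 3) \<Rightarrow> ennreal" where
  "weighted_rot_normsq \<Omega> v =
     (INF w \<in> {w. locally_integrable \<Omega> w \<and>
                   distr_eq \<Omega> (distr_rot (distr \<Omega> v)) (distr \<Omega> w)}.
        l2_normsq \<Omega> (\<lambda>x. bdist \<Omega> x *\<^sub>R w x))"

text \<open>The inequality is void when its right-hand side is infinite; this is stated explicitly
  because \<open>0 * \<infinity> = 0\<close> in \<^typ>\<open>ennreal\<close>.\<close>

definition weighted_rot_inequality :: "point set \<Rightarrow> real \<Rightarrow> bool" where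
  "weighted_rot_inequality \<Omega> P \<longleftrightarrow> 0 \<le> P \<and>
     (\<forall>v\<in>ker_rot_perp \<Omega>. weighted_rot_normsq \<Omega> v < \<infinity> \<longrightarrow>
        l2_normsq \<Omega> v \<le> ennreal P * weighted_rot_normsq \<Omega> v)"

definition weighted_rot_constant :: "point set \<Rightarrow> real" where
  "weighted_rot_constant \<Omega> = Inf {P. weighted_rot_inequality \<Omega> P}"

end

theory Submission
  imports Defs
begin

text \<open>Let \<open>w = rot v\<close>. By Hardy's inequality the functional \<open>\<phi> \<mapsto> \<integral> w \<bullet> \<phi>\<close> is bounded
  on \<open>H\<^sub>0\<^sup>1(\<Omega>)\<^sup>3\<close>, so \<open>- \<Delta>\<psi> = w\<close> has a weak solution with
  \<open>\<parallel>\<nabla>\<psi>\<parallel>\<^sup>2 \<le> H \<parallel>d w\<parallel>\<^sup>2\<close>. As \<open>- \<Delta> = rot rot - \<nabla> div\<close>, the field \<open>v - rot \<psi>\<close>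
  is divergence free, orthogonal to the kernel of \<open>rot\<close>, and its \<open>rot\<close> is the gradient of
  \<open>- div \<psi>\<close>; the Friedrichs--Velte inequality gives
  \<open>\<parallel>v - rot \<psi>\<parallel>\<^sup>2 \<le> \<Gamma> \<parallel>div \<psi>\<parallel>\<^sup>2\<close>. The triangle inequality, Cauchy--Schwarz and
  \<open>\<parallel>\<nabla>\<psi>\<parallel>\<^sup>2 = \<parallel>div \<psi>\<parallel>\<^sup>2 + \<parallel>rot \<psi>\<parallel>\<^sup>2\<close> then give
  \<open>\<parallel>v\<parallel>\<^sup>2 \<le> (1 + \<Gamma>) \<parallel>\<nabla>\<psi>\<parallel>\<^sup>2\<close>.

  The solution \<open>\<psi>\<close> enters only through its gradient \<open>G\<close>, obtained as the \<open>L\<^sub>2\<close> limit of the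
  Jacobians of a minimizing sequence of test fields for
  \<open>\<parallel>\<nabla>\<phi>\<parallel>\<^sup>2 - 2 \<integral> w \<bullet> \<phi>\<close>.\<close>

section \<open>Integration by parts for compactly supported functions\<close>

text \<open>Just enough regularity for dominated convergence of difference quotients. No domain is
  fixed, so the class is closed under translation, which \<open>test_functions \<Omega>\<close> is
  not.\<close>

definition C1c :: "(point \<Rightarrow> real) \<Rightarrow> bool" where
  "C1c f \<longleftrightarrow> (\<forall>x. f differentiable at x) \<and> (\<forall>i. continuous_on UNIV (pderiv_at i f)) \<and>
     compact (closure {x. f x \<noteq> 0})"

lemma closure_supp_zero: "x \<notin> closure {x. f x \<noteq> 0} \<Longrightarrow> f x = 0"
  using closure_subset[of "{x. f x \<noteq> 0}"] by auto

lemma pderiv_at_eq_zero: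
  assumes "x \<notin> closure {x. f x \<noteq> 0}"
  shows "pderiv_at i f x = 0"
proof -
  have "((\<lambda>_. 0) has_derivative (\<lambda>_. 0)) (at x)" by simp
  then have "(f has_derivative (\<lambda>_. 0)) (at x)"
    by (rule has_derivative_transform_within_open[where s="- closure {x. f x \<noteq> 0}"])
      (use assms in \<open>auto dest!: closure_supp_zero\<close>)
  from frechet_derivative_at[OF this] show ?thesis
    by (simp add: pderiv_at_def fun_eq_iff)
qed

lemma
  assumes "C1c f"
  shows C1c_continuous: "continuous_on UNIV f"
    and C1c_continuous_pderiv: "continuous_on UNIV (pderiv_at i f)"
    and C1c_compact: "compact (closure {x. f x \<noteq> 0})"
    and C1c_differentiable: "f differentiable at x"
  using assms by (auto simp: C1c_def intro!: continuous_at_imp_continuous_on differentiable_imp_continuous_within)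

lemma integrable_compact_supp:
  fixes f :: "point \<Rightarrow> 'b::euclidean_space"
  assumes "continuous_on UNIV f" "compact K" "\<And>x. x \<notin> K \<Longrightarrow> f x = 0"
  shows "integrable lborel f"
proof -
  have "integrable lborel (\<lambda>x. indicator K x *\<^sub>R f x)"
    using assms by (intro borel_integrable_compact) (auto intro: continuous_on_subset)
  also have "(\<lambda>x. indicator K x *\<^sub>R f x) = f"
  proof
    fix x show "indicator K x *\<^sub>R f x = f x" using assms(3)[of x] by (cases "x \<in> K") auto
  qed
  finally show ?thesis .
qed

lemma bounded_compact_supp:
  fixes f :: "point \<Rightarrow> 'b::euclidean_space"
  assumes "continuous_on UNIV f" "compact K" "\<And>x. x \<notin> K \<Longrightarrow> f x = 0"
  obtains M where "M \<ge> 0" "\<And>x. norm (f x) \<le> M"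
proof -
  have "bounded (f ` K)"
    using assms by (auto intro!: compact_imp_bounded compact_continuous_image intro: continuous_on_subset)
  then obtain M where M: "M > 0" "\<And>x. x \<in> K \<Longrightarrow> norm (f x) \<le> M"
    by (auto simp: bounded_pos)
  have "norm (f x) \<le> M" for x
    using M assms(3)[of x] by (cases "x \<in> K") auto
  with M that show thesis by (meson less_imp_le)
qed

section \<open>Difference quotients in a coordinate direction\<close>

lemma line_has_derivative:
  assumes "f differentiable at (x + t *\<^sub>R axis i 1)"
  shows "((\<lambda>t. f (x + t *\<^sub>R axis i 1)) has_vector_derivative pderiv_at i f (x + t *\<^sub>R axis i 1)) (at t)"
proof -
  let ?D = "frechet_derivative f (at (x + t *\<^sub>R axis i 1))"
  have D: "(f has_derivative ?D) (at (x + t *\<^sub>R axis i 1))"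
    using assms by (simp add: frechet_derivative_works)
  have "((\<lambda>t. x + t *\<^sub>R axis i (1::real)) has_derivative (\<lambda>s. s *\<^sub>R axis i 1)) (at t)"
    by (auto intro!: derivative_eq_intros)
  from has_derivative_compose[OF this D]
  have "((\<lambda>t. f (x + t *\<^sub>R axis i 1)) has_derivative (\<lambda>s. ?D (s *\<^sub>R axis i 1))) (at t)" .
  moreover have "?D (s *\<^sub>R axis i 1) = s *\<^sub>R pderiv_at i f (x + t *\<^sub>R axis i 1)" for s
    using linear_cmul[OF has_derivative_linear[OF D]] by (simp add: pderiv_at_def)
  ultimately show ?thesis by (simp add: has_vector_derivative_def)
qed

text \<open>Mean value inequality on the line through \<open>x\<close> in direction
  \<open>axis i 1\<close>. It provides the dominating function for the passage to the limit under
  the integral.\<close>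

lemma difference_quotient_bound:
  fixes f :: "point \<Rightarrow> real"
  assumes "\<And>x. f differentiable at x" "\<And>x. \<bar>pderiv_at i f x\<bar> \<le> M"
  shows "\<bar>f (x + h *\<^sub>R axis i 1) - f x\<bar> \<le> M * \<bar>h\<bar>"
proof -
  have "norm (f (x + h *\<^sub>R axis i 1) - f (x + 0 *\<^sub>R axis i 1)) \<le> M * norm (h - 0)"
  proof (rule differentiable_bound[where S=UNIV and f="\<lambda>t. f (x + t *\<^sub>R axis i 1)"])
    show "((\<lambda>t. f (x + t *\<^sub>R axis i 1)) has_derivative
         (\<lambda>s. s *\<^sub>R pderiv_at i f (x + t *\<^sub>R axis i 1))) (at t within UNIV)" for t
      using line_has_derivative[OF assms(1), where x=x and t=t and i=i] by (simp add: has_vector_derivative_def)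
    show "onorm (\<lambda>s. s *\<^sub>R pderiv_at i f (x + t *\<^sub>R axis i 1)) \<le> M" for t
    proof (intro onorm_le)
      fix s :: real
      show "norm (s *\<^sub>R pderiv_at i f (x + t *\<^sub>R axis i 1)) \<le> M * norm s"
        using mult_right_mono[OF assms(2) abs_ge_zero[of s]] by (simp add: abs_mult mult.commute)
    qed
  qed auto
  then show ?thesis by simp
qed

text \<open>Dominated convergence with majorant \<open>M * norm (g x)\<close>, where
  \<open>M\<close> bounds the partial derivative. The steps \<open>h n\<close> may have either sign,
  and both signs occur later.\<close>

lemma difference_quotient_integral:
  fixes f g :: "point \<Rightarrow> real"
  assumes f: "C1c f" and g: "integrable lborel g" and h: "h \<longlonglongrightarrow> 0" "\<And>n. h n \<noteq> (0::real)"
  shows "(\<lambda>n. \<integral>x. (f (x + h n *\<^sub>R axis i 1) - f x) / h n * g x \<partial>lborel)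
           \<longlonglongrightarrow> (\<integral>x. pderiv_at i f x * g x \<partial>lborel)"
proof -
  obtain M where M: "\<And>x. norm (pderiv_at i f x) \<le> M"
    using bounded_compact_supp[OF C1c_continuous_pderiv[OF f] C1c_compact[OF f] pderiv_at_eq_zero[where f=f]] by metis
  have [measurable]: "f \<in> borel_measurable borel" "pderiv_at i f \<in> borel_measurable borel"
    using C1c_continuous[OF f] C1c_continuous_pderiv[OF f] by (auto intro: borel_measurable_continuous_onI)
  have [measurable]: "g \<in> borel_measurable lborel" using g by auto
  show ?thesis
  proof (rule integral_dominated_convergence[where w="\<lambda>x. M * norm (g x)"])
    show "AE x in lborel. (\<lambda>n. (f (x + h n *\<^sub>R axis i 1) - f x) / h n * g x) \<longlonglongrightarrow> pderiv_at i f x * g x"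
    proof (intro AE_I2 tendsto_mult_right)
      fix x
      have "((\<lambda>t. f (x + t *\<^sub>R axis i 1)) has_field_derivative pderiv_at i f x) (at 0)"
        using line_has_derivative[OF C1c_differentiable[OF f], where x=x and t=0 and i=i]
        by (simp add: has_real_derivative_iff_has_vector_derivative)
      then have "((\<lambda>t. (f (x + t *\<^sub>R axis i 1) - f x) / t) \<longlongrightarrow> pderiv_at i f x) (at 0)"
        by (simp add: DERIV_def)
      moreover have "filterlim h (at 0) sequentially"
        using h by (auto simp: filterlim_at)
      ultimately show "(\<lambda>n. (f (x + h n *\<^sub>R axis i 1) - f x) / h n) \<longlonglongrightarrow> pderiv_at i f x"
        by (rule filterlim_compose)
    qed
    show "AE x in lborel. norm ((f (x + h n *\<^sub>R axis i 1) - f x) / h n * g x) \<le> M * norm (g x)" for n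
    proof (rule AE_I2)
      fix x
      have "\<bar>f (x + h n *\<^sub>R axis i 1) - f x\<bar> / \<bar>h n\<bar> \<le> M"
        using difference_quotient_bound[OF C1c_differentiable[OF f], where i=i and M=M and h="h n" and x=x] M h(2)[of n]
        by (simp add: divide_le_eq)
      from mult_right_mono[OF this abs_ge_zero[of "g x"]]
      show "norm ((f (x + h n *\<^sub>R axis i 1) - f x) / h n * g x) \<le> M * norm (g x)"
        by (simp add: abs_mult)
    qed
  qed (use g in auto)
qed

lemma lborel_integral_translate:
  fixes f :: "point \<Rightarrow> real"
  assumes "f \<in> borel_measurable borel"
  shows "(\<integral>x. f (x + a) \<partial>lborel) = (\<integral>x. f x \<partial>lborel)"
proof -
  have "(\<integral>x. f x \<partial>lborel) = (\<integral>x. f x \<partial>Measure_Space.distr lborel borel ((+) a))"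
    by (simp add: lborel_distr_plus)
  also have "\<dots> = (\<integral>x. f (x + a) \<partial>lborel)"
    using assms by (subst integral_distr) (auto simp: add.commute)
  finally show ?thesis by simp
qed

lemma integrable_mult_compact_supp:
  fixes f g :: "point \<Rightarrow> real"
  assumes "continuous_on UNIV f" "compact K" "\<And>x. x \<notin> K \<Longrightarrow> f x = 0" "continuous_on UNIV g"
  shows "integrable lborel (\<lambda>x. f x * g x)"
  using assms by (intro integrable_compact_supp[where K=K]) (auto intro!: continuous_intros)

text \<open>Discrete integration by parts: translation invariance of \<open>lborel\<close> moves the
  shift from \<open>f\<close> to \<open>g\<close> and reverses it. Only continuity and compact
  support enter, so a partial derivative can take the place of \<open>f\<close>.\<close>

lemma difference_quotient_by_parts:
  fixes f g :: "point \<Rightarrow> real"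
  assumes f: "continuous_on UNIV f" "compact K" "\<And>x. x \<notin> K \<Longrightarrow> f x = 0"
    and g: "continuous_on UNIV g" "compact L" "\<And>x. x \<notin> L \<Longrightarrow> g x = 0"
  shows "(\<integral>x. (f (x + h *\<^sub>R axis i 1) - f x) / h * g x \<partial>lborel) =
         - (\<integral>x. (g (x + (- h) *\<^sub>R axis i 1) - g x) / (- h) * f x \<partial>lborel)"
proof -
  have fa: "continuous_on UNIV (\<lambda>x. f (x + a))" and ga: "continuous_on UNIV (\<lambda>x. g (x + a))" for a
    by (auto intro!: continuous_intros continuous_on_compose2[OF f(1)] continuous_on_compose2[OF g(1)])
  have i1: "integrable lborel (\<lambda>x. f (x + a) * g x)" for a
    using integrable_mult_compact_supp[OF g fa] by (simp add: mult.commute)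
  have i2: "integrable lborel (\<lambda>x. g (x + a) * f x)" for a
    using integrable_mult_compact_supp[OF f ga] by (simp add: mult.commute)
  have i3: "integrable lborel (\<lambda>x. f x * g x)" "integrable lborel (\<lambda>x. g x * f x)"
    using i1[of 0] i2[of 0] by auto
  have tr: "(\<integral>x. f (x + h *\<^sub>R axis i 1) * g x \<partial>lborel) = (\<integral>x. g (x + (- h) *\<^sub>R axis i 1) * f x \<partial>lborel)"
    using lborel_integral_translate[of "\<lambda>x. g (x + (- h) *\<^sub>R axis i 1) * f x" "h *\<^sub>R axis i 1"]
      borel_measurable_continuous_onI[OF ga[of "(- h) *\<^sub>R axis i 1"]] borel_measurable_continuous_onI[OF f(1)]
    by (simp add: mult.commute)
  have "(\<integral>x. (f (x + h *\<^sub>R axis i 1) - f x) / h * g x \<partial>lborel) =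
        (\<integral>x. (f (x + h *\<^sub>R axis i 1) * g x - f x * g x) / h \<partial>lborel)"
    by (simp add: algebra_simps diff_divide_distrib)
  also have "\<dots> = ((\<integral>x. f (x + h *\<^sub>R axis i 1) * g x \<partial>lborel) - (\<integral>x. f x * g x \<partial>lborel)) / h"
    using i1 i3 by (simp add: Bochner_Integration.integral_diff)
  also have "\<dots> = ((\<integral>x. g (x + (- h) *\<^sub>R axis i 1) * f x \<partial>lborel) - (\<integral>x. g x * f x \<partial>lborel)) / h"
    by (simp only: tr) (simp add: mult.commute)
  also have "\<dots> = (\<integral>x. (g (x + (- h) *\<^sub>R axis i 1) * f x - g x * f x) / h \<partial>lborel)"
    using i2[of "(- h) *\<^sub>R axis i 1"] i3 by (simp add: Bochner_Integration.integral_diff)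
  also have "\<dots> = (\<integral>x. - ((g (x + (- h) *\<^sub>R axis i 1) - g x) / (- h) * f x) \<partial>lborel)"
    by (rule Bochner_Integration.integral_cong) (auto simp: algebra_simps diff_divide_distrib)
  also have "\<dots> = - (\<integral>x. (g (x + (- h) *\<^sub>R axis i 1) - g x) / (- h) * f x \<partial>lborel)"
    by (rule Bochner_Integration.integral_minus)
  finally show ?thesis .
qed

text \<open>Step sizes of both signs, because discrete integration by parts turns \<open>h\<close>
  into \<open>- h\<close>.\<close>

lemma null_sequence: "(\<lambda>n. 1 / real (Suc n)) \<longlonglongrightarrow> 0" "1 / real (Suc n) \<noteq> 0"
  "(\<lambda>n. - (1 / real (Suc n))) \<longlonglongrightarrow> 0" "- (1 / real (Suc n)) \<noteq> 0"
  using LIMSEQ_inverse_real_of_nat tendsto_minus[OF LIMSEQ_inverse_real_of_nat]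
  by (auto simp: inverse_eq_divide)

text \<open>Both sides are limits of the two sides of the discrete identity with step
  \<open>1 / real (Suc n)\<close>, and limits are unique.\<close>

lemma integration_by_parts:
  assumes f: "C1c f" and g: "C1c g"
  shows "(\<integral>x. pderiv_at i f x * g x \<partial>lborel) = - (\<integral>x. pderiv_at i g x * f x \<partial>lborel)"
proof -
  note cf = C1c_continuous[OF f] C1c_compact[OF f] closure_supp_zero[where f=f]
  note cg = C1c_continuous[OF g] C1c_compact[OF g] closure_supp_zero[where f=g]
  let ?h = "\<lambda>n. 1 / real (Suc n)"
  have eq: "(\<integral>x. (f (x + ?h n *\<^sub>R axis i 1) - f x) / ?h n * g x \<partial>lborel) =
      - (\<integral>x. (g (x + (- ?h n) *\<^sub>R axis i 1) - g x) / (- ?h n) * f x \<partial>lborel)" for n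
    by (rule difference_quotient_by_parts[OF cf cg])
  have "(\<lambda>n. \<integral>x. (f (x + ?h n *\<^sub>R axis i 1) - f x) / ?h n * g x \<partial>lborel)
      \<longlonglongrightarrow> - (\<integral>x. pderiv_at i g x * f x \<partial>lborel)"
    unfolding eq
    by (intro tendsto_minus difference_quotient_integral[OF g integrable_compact_supp[OF cf] null_sequence(3,4)])
  with difference_quotient_integral[OF f integrable_compact_supp[OF cg] null_sequence(1,2)]
  show ?thesis by (rule LIMSEQ_unique)
qed

lemma pderiv_at_translate:
  assumes "\<And>x. f differentiable at x"
  shows "pderiv_at i (\<lambda>x. f (x + a)) x = pderiv_at i f (x + a)"
    and "(\<lambda>x. f (x + a)) differentiable at x"
proof -
  have "((\<lambda>x. x + a) has_derivative (\<lambda>y. y)) (at x)"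
    by (auto intro!: derivative_eq_intros)
  from has_derivative_compose[OF this assms[unfolded frechet_derivative_works]]
  have *: "((\<lambda>x. f (x + a)) has_derivative frechet_derivative f (at (x + a))) (at x)" by simp
  from frechet_derivative_at[OF *] show "pderiv_at i (\<lambda>x. f (x + a)) x = pderiv_at i f (x + a)"
    by (simp add: pderiv_at_def)
  from * show "(\<lambda>x. f (x + a)) differentiable at x" by (rule differentiableI)
qed

lemma C1c_translate:
  assumes "C1c f"
  shows "C1c (\<lambda>x. f (x + a))"
proof -
  have [simp]: "pderiv_at i (\<lambda>x. f (x + a)) = (\<lambda>x. pderiv_at i f (x + a))" for i
    using pderiv_at_translate(1)[OF C1c_differentiable[OF assms]] by auto
  have "{x. f (x + a) \<noteq> 0} = (\<lambda>x. - a + x) ` {x. f x \<noteq> 0}"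
  proof safe
    fix x assume "f (x + a) \<noteq> 0"
    then show "x \<in> (\<lambda>x. - a + x) ` {x. f x \<noteq> 0}" by (intro image_eqI[of _ _ "x + a"]) auto
  qed simp
  then have "compact (closure {x. f (x + a) \<noteq> 0})"
    using compact_translation[OF C1c_compact[OF assms], of "- a"] by (simp only: closure_translation)
  then show ?thesis
    unfolding C1c_def
    using pderiv_at_translate(2)[OF C1c_differentiable[OF assms]]
    by (auto intro!: continuous_on_compose2[OF C1c_continuous_pderiv[OF assms]] continuous_intros)
qed

text \<open>Only first derivatives enter, so one of the two is replaced by a difference quotient; this
  avoids the symmetry of second derivatives.\<close>

lemma integral_pderiv_swap:
  assumes f: "C1c f" and g: "C1c g"
  shows "(\<integral>x. pderiv_at i f x * pderiv_at j g x \<partial>lborel) = (\<integral>x. pderiv_at j f x * pderiv_at i g x \<partial>lborel)"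
proof -
  note cf = C1c_continuous[OF f] C1c_compact[OF f] closure_supp_zero[where f=f]
  note cdf = C1c_continuous_pderiv[OF f] C1c_compact[OF f] pderiv_at_eq_zero[where f=f]
  note cdg = C1c_continuous_pderiv[OF g] C1c_compact[OF g] pderiv_at_eq_zero[where f=g]
  have i1: "integrable lborel (\<lambda>x. pderiv_at i f x * g (x + a))" for a
    using integrable_mult_compact_supp[OF cdf C1c_continuous[OF C1c_translate[OF g]]] .
  have i2: "integrable lborel (\<lambda>x. pderiv_at i g (x + a) * f x)" for a
    using integrable_mult_compact_supp[OF cf, of "\<lambda>x. pderiv_at i g (x + a)"]
      C1c_continuous_pderiv[OF C1c_translate[OF g], of i a] pderiv_at_translate(1)[OF C1c_differentiable[OF g]]
    by (simp add: mult.commute)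
  let ?h = "\<lambda>n. 1 / real (Suc n)"
  \<comment> \<open>Integration by parts in direction \<open>i\<close>, applied to \<open>f\<close>
    and the translates of \<open>g\<close>, moves the derivative onto the quotient of
    \<open>g\<close>; discrete integration by parts in direction \<open>j\<close> then moves the
    quotient onto \<open>f\<close>. The two minus signs cancel.\<close>
  have eq: "(\<integral>x. (g (x + ?h n *\<^sub>R axis j 1) - g x) / ?h n * pderiv_at i f x \<partial>lborel) =
        (\<integral>x. (f (x + (- ?h n) *\<^sub>R axis j 1) - f x) / (- ?h n) * pderiv_at i g x \<partial>lborel)" for n
  proof -
    let ?a = "?h n *\<^sub>R axis j 1"
    have "(\<integral>x. (g (x + ?a) - g x) / ?h n * pderiv_at i f x \<partial>lborel) =
        (\<integral>x. (pderiv_at i f x * g (x + ?a) - pderiv_at i f x * g (x + 0)) / ?h n \<partial>lborel)"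
      by (rule Bochner_Integration.integral_cong) (auto simp: algebra_simps)
    also have "\<dots> = ((\<integral>x. pderiv_at i f x * g (x + ?a) \<partial>lborel) -
        (\<integral>x. pderiv_at i f x * g (x + 0) \<partial>lborel)) / ?h n"
      by (subst Bochner_Integration.integral_diff[OF i1 i1, symmetric]) (rule integral_divide_zero)
    also have "\<dots> = - ((\<integral>x. pderiv_at i g (x + ?a) * f x \<partial>lborel) -
        (\<integral>x. pderiv_at i g (x + 0) * f x \<partial>lborel)) / ?h n"
      by (simp only: integration_by_parts[OF f C1c_translate[OF g]] pderiv_at_translate(1)[OF C1c_differentiable[OF g]])
         (simp only: minus_diff_minus)
    also have "\<dots> = - (((\<integral>x. pderiv_at i g (x + ?a) * f x \<partial>lborel) -
        (\<integral>x. pderiv_at i g (x + 0) * f x \<partial>lborel)) / ?h n)"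
      by (rule minus_divide_left[symmetric])
    also have "((\<integral>x. pderiv_at i g (x + ?a) * f x \<partial>lborel) -
        (\<integral>x. pderiv_at i g (x + 0) * f x \<partial>lborel)) / ?h n =
        (\<integral>x. (pderiv_at i g (x + ?a) * f x - pderiv_at i g (x + 0) * f x) / ?h n \<partial>lborel)"
      by (subst Bochner_Integration.integral_diff[OF i2 i2, symmetric]) (rule integral_divide_zero[symmetric])
    also have "\<dots> = (\<integral>x. (pderiv_at i g (x + ?a) - pderiv_at i g x) / ?h n * f x \<partial>lborel)"
      by (rule Bochner_Integration.integral_cong) (auto simp: algebra_simps)
    also have "- \<dots> = (\<integral>x. (f (x + (- ?h n) *\<^sub>R axis j 1) - f x) / (- ?h n) * pderiv_at i g x \<partial>lborel)"
      by (subst difference_quotient_by_parts[OF cdg cf]) (assumption, assumption, rule minus_minus)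
    finally show ?thesis .
  qed
  have "(\<lambda>n. \<integral>x. (f (x + (- ?h n) *\<^sub>R axis j 1) - f x) / (- ?h n) * pderiv_at i g x \<partial>lborel)
     \<longlonglongrightarrow> (\<integral>x. pderiv_at j g x * pderiv_at i f x \<partial>lborel)"
    unfolding eq[symmetric]
    by (rule difference_quotient_integral[OF g integrable_compact_supp[OF cdf] null_sequence(1,2)])
  from LIMSEQ_unique[OF this difference_quotient_integral[OF f integrable_compact_supp[OF cdg] null_sequence(3,4)]]
  show ?thesis by (simp add: mult.commute)
qed

section \<open>The space of square integrable functions\<close>

lemma L2_iff: "f \<in> L2 \<Omega> \<longleftrightarrow>
    f \<in> borel_measurable (lebesgue_on \<Omega>) \<and> integrable (lebesgue_on \<Omega>) (\<lambda>x. (norm (f x))\<^sup>2)"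
  by (auto simp: L2_def l2_normsq_def integrable_iff_bounded)

lemma L2_measurable: "f \<in> L2 \<Omega> \<Longrightarrow> f \<in> borel_measurable (lebesgue_on \<Omega>)"
  by (simp add: L2_iff)

lemma L2_inner_integrable:
  assumes "f \<in> L2 \<Omega>" "g \<in> L2 \<Omega>"
  shows "integrable (lebesgue_on \<Omega>) (\<lambda>x. f x \<bullet> g x)"
proof (rule Bochner_Integration.integrable_bound)
  show "integrable (lebesgue_on \<Omega>) (\<lambda>x. (norm (f x))\<^sup>2 + (norm (g x))\<^sup>2)"
    using assms by (auto simp: L2_iff)
  show "AE x in lebesgue_on \<Omega>. norm (f x \<bullet> g x) \<le> norm ((norm (f x))\<^sup>2 + (norm (g x))\<^sup>2)"
  proof (rule AE_I2)
    fix x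
    have "\<bar>f x \<bullet> g x\<bar> \<le> norm (f x) * norm (g x)" by (rule Cauchy_Schwarz_ineq2)
    also have "\<dots> \<le> (norm (f x))\<^sup>2 + (norm (g x))\<^sup>2"
      using sum_squares_bound[of "norm (f x)" "norm (g x)"] mult_nonneg_nonneg[of "norm (f x)" "norm (g x)"]
      unfolding mult.assoc by (smt (verit) norm_ge_zero)
    finally show "norm (f x \<bullet> g x) \<le> norm ((norm (f x))\<^sup>2 + (norm (g x))\<^sup>2)" by simp
  qed
  show "(\<lambda>x. f x \<bullet> g x) \<in> borel_measurable (lebesgue_on \<Omega>)"
    using assms by (auto simp: L2_iff)
qed

lemma l2_normsq_eq_inner:
  assumes "f \<in> L2 \<Omega>"
  shows "l2_normsq \<Omega> f = ennreal (l2_inner \<Omega> f f)"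
  using L2_inner_integrable[OF assms assms]
  by (simp add: l2_normsq_def l2_inner_def dot_square_norm nn_integral_eq_integral)

lemma L2_scaleR: "f \<in> L2 \<Omega> \<Longrightarrow> (\<lambda>x. c *\<^sub>R f x) \<in> L2 \<Omega>"
  by (auto simp: L2_iff power_mult_distrib)

lemma L2_add:
  assumes "f \<in> L2 \<Omega>" "g \<in> L2 \<Omega>"
  shows "(\<lambda>x. f x + g x) \<in> L2 \<Omega>"
proof -
  have "(\<lambda>x. (norm (f x + g x))\<^sup>2) = (\<lambda>x. (norm (f x))\<^sup>2 + 2 * (f x \<bullet> g x) + (norm (g x))\<^sup>2)"
    by (auto simp: power2_norm_eq_inner inner_add inner_commute)
  with assms L2_inner_integrable[OF assms] show ?thesis by (auto simp: L2_iff)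
qed

lemma L2_diff:
  assumes "f \<in> L2 \<Omega>" "g \<in> L2 \<Omega>"
  shows "(\<lambda>x. f x - g x) \<in> L2 \<Omega>"
  using L2_add[OF assms(1) L2_scaleR[OF assms(2), of "-1"]] by simp

text \<open>Entries, trace and curl are all linear in a matrix, so this one lemma puts the
  quantities derived from a Jacobian or its limit into \<open>L2 \<Omega>\<close>.\<close>

lemma L2_bounded_linear:
  assumes "bounded_linear T" "f \<in> L2 \<Omega>"
  shows "(\<lambda>x. T (f x)) \<in> L2 \<Omega>"
proof -
  obtain K where K: "\<And>x. norm (T x) \<le> norm x * K" "K > 0"
    using bounded_linear.pos_bounded[OF assms(1)] by blast
  have [measurable]: "T \<in> borel_measurable borel"
    using assms(1) by (intro borel_measurable_continuous_onI linear_continuous_on)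
  have [measurable]: "f \<in> borel_measurable (lebesgue_on \<Omega>)" using assms(2) by (simp add: L2_iff)
  have "integrable (lebesgue_on \<Omega>) (\<lambda>x. (norm (T (f x)))\<^sup>2)"
  proof (rule Bochner_Integration.integrable_bound)
    show "integrable (lebesgue_on \<Omega>) (\<lambda>x. K\<^sup>2 * (norm (f x))\<^sup>2)"
      using assms by (auto simp: L2_iff)
    show "AE x in lebesgue_on \<Omega>. norm ((norm (T (f x)))\<^sup>2) \<le> norm (K\<^sup>2 * (norm (f x))\<^sup>2)"
      using K by (intro AE_I2) (simp add: power_mult_distrib[symmetric] power_mono mult.commute)
  qed measurable
  then show ?thesis by (simp add: L2_iff)
qed

lemma l2_inner_commute: "l2_inner \<Omega> f g = l2_inner \<Omega> g f"
  by (simp add: l2_inner_def inner_commute)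

lemma l2_inner_nonneg: "0 \<le> l2_inner \<Omega> f f"
  by (simp add: l2_inner_def)

lemma l2_inner_add_left:
  assumes "f \<in> L2 \<Omega>" "g \<in> L2 \<Omega>" "h \<in> L2 \<Omega>"
  shows "l2_inner \<Omega> (\<lambda>x. f x + g x) h = l2_inner \<Omega> f h + l2_inner \<Omega> g h"
  using assms by (simp add: l2_inner_def inner_add_left Bochner_Integration.integral_add L2_inner_integrable)

lemma l2_inner_diff_left:
  assumes "f \<in> L2 \<Omega>" "g \<in> L2 \<Omega>" "h \<in> L2 \<Omega>"
  shows "l2_inner \<Omega> (\<lambda>x. f x - g x) h = l2_inner \<Omega> f h - l2_inner \<Omega> g h"
  using assms by (simp add: l2_inner_def inner_diff_left Bochner_Integration.integral_diff L2_inner_integrable)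

lemma l2_inner_scaleR_left: "l2_inner \<Omega> (\<lambda>x. c *\<^sub>R f x) h = c * l2_inner \<Omega> f h"
  by (simp add: l2_inner_def)

lemma l2_inner_add_right:
  assumes "f \<in> L2 \<Omega>" "g \<in> L2 \<Omega>" "h \<in> L2 \<Omega>"
  shows "l2_inner \<Omega> h (\<lambda>x. f x + g x) = l2_inner \<Omega> h f + l2_inner \<Omega> h g"
  using l2_inner_add_left[OF assms] by (simp add: l2_inner_commute)

lemma l2_inner_diff_right:
  assumes "f \<in> L2 \<Omega>" "g \<in> L2 \<Omega>" "h \<in> L2 \<Omega>"
  shows "l2_inner \<Omega> h (\<lambda>x. f x - g x) = l2_inner \<Omega> h f - l2_inner \<Omega> h g"
  using l2_inner_diff_left[OF assms] by (simp add: l2_inner_commute)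

lemma l2_inner_scaleR_right: "l2_inner \<Omega> h (\<lambda>x. c *\<^sub>R f x) = c * l2_inner \<Omega> h f"
  by (simp add: l2_inner_def)

text \<open>Discriminant condition for a nonnegative quadratic in \<open>t\<close>. It serves both
  Cauchy--Schwarz and the first-variation estimate along a minimizing sequence.\<close>

lemma quadratic_nonneg_imp:
  fixes a b c :: real
  assumes "\<And>t. 0 \<le> c + 2 * t * b + t\<^sup>2 * a" "0 \<le> a"
  shows "b\<^sup>2 \<le> a * c"
proof (cases "a = 0")
  case True
  have "b = 0"
  proof (rule ccontr)
    assume "b \<noteq> 0"
    \<comment> \<open>This \<open>t\<close> would give the quadratic, here linear in
      \<open>t\<close>, the value \<open>-1\<close>.\<close>
    with assms(1)[of "- (c + 1) / (2 * b)"] True show False by (simp add: field_simps)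
  qed
  then show ?thesis using True by simp
next
  case False
  with assms(2) have "a > 0" by simp
  with assms(1)[of "- b / a"] show ?thesis by (simp add: field_simps power2_eq_square)
qed

section \<open>Cauchy--Schwarz, the triangle inequality and limits of inner products\<close>

lemma l2_inner_quadratic:
  assumes "f \<in> L2 \<Omega>" "g \<in> L2 \<Omega>"
  shows "l2_inner \<Omega> (\<lambda>x. s *\<^sub>R f x + t *\<^sub>R g x) (\<lambda>x. s *\<^sub>R f x + t *\<^sub>R g x) =
    s\<^sup>2 * l2_inner \<Omega> f f + 2 * s * t * l2_inner \<Omega> f g + t\<^sup>2 * l2_inner \<Omega> g g"
  using assms
  by (simp add: l2_inner_add_left l2_inner_add_right L2_add L2_scaleR l2_inner_scaleR_left
      l2_inner_scaleR_right l2_inner_commute[of _ g f] power2_eq_square algebra_simps)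

lemma l2_Cauchy_Schwarz:
  assumes "f \<in> L2 \<Omega>" "g \<in> L2 \<Omega>"
  shows "(l2_inner \<Omega> f g)\<^sup>2 \<le> l2_inner \<Omega> f f * l2_inner \<Omega> g g"
proof -
  have "(l2_inner \<Omega> f g)\<^sup>2 \<le> l2_inner \<Omega> g g * l2_inner \<Omega> f f"
    using l2_inner_quadratic[OF assms, of 1] l2_inner_nonneg[of \<Omega> "\<lambda>x. 1 *\<^sub>R f x + _ *\<^sub>R g x"]
    by (intro quadratic_nonneg_imp) (auto simp: l2_inner_nonneg)
  then show ?thesis by (simp add: mult.commute)
qed

lemma l2_Cauchy_Schwarz_sqrt:
  assumes "f \<in> L2 \<Omega>" "g \<in> L2 \<Omega>"
  shows "\<bar>l2_inner \<Omega> f g\<bar> \<le> sqrt (l2_inner \<Omega> f f) * sqrt (l2_inner \<Omega> g g)"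
  using real_sqrt_le_mono[OF l2_Cauchy_Schwarz[OF assms]] by (simp add: real_sqrt_mult)

lemma l2_triangle:
  assumes "f \<in> L2 \<Omega>" "g \<in> L2 \<Omega>"
  shows "sqrt (l2_inner \<Omega> (\<lambda>x. f x + g x) (\<lambda>x. f x + g x)) \<le>
    sqrt (l2_inner \<Omega> f f) + sqrt (l2_inner \<Omega> g g)"
proof (rule real_le_lsqrt)
  show "l2_inner \<Omega> (\<lambda>x. f x + g x) (\<lambda>x. f x + g x) \<le> (sqrt (l2_inner \<Omega> f f) + sqrt (l2_inner \<Omega> g g))\<^sup>2"
    using l2_inner_quadratic[OF assms, of 1 1] l2_Cauchy_Schwarz_sqrt[OF assms]
    by (simp add: power2_sum l2_inner_nonneg)
qed (simp add: l2_inner_nonneg)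

text \<open>Writing \<open>f n = F + u n\<close> and \<open>g n = G + v n\<close>, the error is a
  sum of three inner products, each containing \<open>u n\<close> or \<open>v n\<close>;
  Cauchy--Schwarz makes all of them small.\<close>

lemma l2_inner_tendsto:
  assumes "\<And>n. f n \<in> L2 \<Omega>" "\<And>n. g n \<in> L2 \<Omega>" "F \<in> L2 \<Omega>" "G \<in> L2 \<Omega>"
    and f: "(\<lambda>n. l2_inner \<Omega> (\<lambda>x. f n x - F x) (\<lambda>x. f n x - F x)) \<longlonglongrightarrow> 0"
    and g: "(\<lambda>n. l2_inner \<Omega> (\<lambda>x. g n x - G x) (\<lambda>x. g n x - G x)) \<longlonglongrightarrow> 0"
  shows "(\<lambda>n. l2_inner \<Omega> (f n) (g n)) \<longlonglongrightarrow> l2_inner \<Omega> F G"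
proof -
  define u where "u n = (\<lambda>x. f n x - F x)" for n
  define v where "v n = (\<lambda>x. g n x - G x)" for n
  have u: "u n \<in> L2 \<Omega>" and v: "v n \<in> L2 \<Omega>" for n using assms by (auto simp: u_def v_def L2_diff)
  have lim_u: "(\<lambda>n. sqrt (l2_inner \<Omega> (u n) (u n))) \<longlonglongrightarrow> 0"
    and lim_v: "(\<lambda>n. sqrt (l2_inner \<Omega> (v n) (v n))) \<longlonglongrightarrow> 0"
    using tendsto_real_sqrt[OF f] tendsto_real_sqrt[OF g] by (simp_all add: u_def v_def)
  have eq: "l2_inner \<Omega> (f n) (g n) - l2_inner \<Omega> F G =
      l2_inner \<Omega> (u n) (v n) + l2_inner \<Omega> (u n) G + l2_inner \<Omega> F (v n)" for n
    using assms u[of n] v[of n]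
    by (simp add: u_def v_def l2_inner_diff_left l2_inner_diff_right)
  have "(\<lambda>n. l2_inner \<Omega> (f n) (g n) - l2_inner \<Omega> F G) \<longlonglongrightarrow> 0"
  proof (rule Lim_null_comparison)
    let ?N = "\<lambda>f. sqrt (l2_inner \<Omega> f f)"
    let ?b = "\<lambda>n. ?N (u n) * ?N (v n) + ?N (u n) * ?N G + ?N F * ?N (v n)"
    show "\<forall>\<^sub>F n in sequentially. norm (l2_inner \<Omega> (f n) (g n) - l2_inner \<Omega> F G) \<le> ?b n"
    proof (rule always_eventually, rule allI)
      fix n
      show "norm (l2_inner \<Omega> (f n) (g n) - l2_inner \<Omega> F G) \<le> ?b n"
        using l2_Cauchy_Schwarz_sqrt[OF u[of n] v[of n]] l2_Cauchy_Schwarz_sqrt[OF u[of n] assms(4)]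
          l2_Cauchy_Schwarz_sqrt[OF assms(3) v[of n]]
        unfolding eq real_norm_def by linarith
    qed
    show "?b \<longlonglongrightarrow> 0" by (rule tendsto_eq_intros lim_u lim_v refl | simp)+
  qed
  then show ?thesis by (simp add: LIM_zero_iff)
qed

lemma l2_inner_tendsto_left:
  assumes "\<And>n. f n \<in> L2 \<Omega>" "F \<in> L2 \<Omega>" "G \<in> L2 \<Omega>"
    and "(\<lambda>n. l2_inner \<Omega> (\<lambda>x. f n x - F x) (\<lambda>x. f n x - F x)) \<longlonglongrightarrow> 0"
  shows "(\<lambda>n. l2_inner \<Omega> (f n) G) \<longlonglongrightarrow> l2_inner \<Omega> F G"
  using assms by (intro l2_inner_tendsto) (auto simp: l2_inner_def)

text \<open>\<open>T\<close> enlarges squared distances by at most \<open>K^2\<close>. Thus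
  convergence of Jacobians passes to their entries and curls.\<close>

lemma l2_tendsto_bounded_linear:
  assumes T: "bounded_linear T" and f: "\<And>n. f n \<in> L2 \<Omega>" "F \<in> L2 \<Omega>"
    and lim: "(\<lambda>n. l2_inner \<Omega> (\<lambda>x. f n x - F x) (\<lambda>x. f n x - F x)) \<longlonglongrightarrow> 0"
  shows "(\<lambda>n. l2_inner \<Omega> (\<lambda>x. T (f n x) - T (F x)) (\<lambda>x. T (f n x) - T (F x))) \<longlonglongrightarrow> 0"
proof -
  obtain K where K: "\<And>x. norm (T x) \<le> norm x * K" "K > 0"
    using bounded_linear.pos_bounded[OF T] by blast
  have le: "l2_inner \<Omega> (\<lambda>x. T (f n x) - T (F x)) (\<lambda>x. T (f n x) - T (F x)) \<le>
      K\<^sup>2 * l2_inner \<Omega> (\<lambda>x. f n x - F x) (\<lambda>x. f n x - F x)" for n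
  proof -
    note d = L2_diff[OF f(1)[of n] f(2)]
    note Td = L2_bounded_linear[OF T d]
    have "l2_inner \<Omega> (\<lambda>x. T (f n x - F x)) (\<lambda>x. T (f n x - F x)) \<le>
      (\<integral>x. K\<^sup>2 * ((f n x - F x) \<bullet> (f n x - F x)) \<partial>lebesgue_on \<Omega>)"
      unfolding l2_inner_def
      using L2_inner_integrable[OF d d] L2_inner_integrable[OF Td Td]
    proof (intro integral_mono)
      fix x
      have "(norm (T (f n x - F x)))\<^sup>2 \<le> (norm (f n x - F x) * K)\<^sup>2"
        by (intro power_mono K) simp
      then show "T (f n x - F x) \<bullet> T (f n x - F x) \<le> K\<^sup>2 * ((f n x - F x) \<bullet> (f n x - F x))"
        by (simp add: dot_square_norm power_mult_distrib mult.commute)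
    qed auto
    then show ?thesis
      by (simp add: l2_inner_def linear_diff[OF bounded_linear.linear[OF T]])
  qed
  show ?thesis
    by (rule tendsto_sandwich[OF _ _ tendsto_const tendsto_mult_right_zero[OF lim, of "K\<^sup>2"]])
      (auto intro!: always_eventually simp: l2_inner_nonneg le)
qed

text \<open>Riesz--Fischer for rapidly convergent sequences. By Cauchy--Schwarz the pointwise increments
  are almost everywhere dominated by a geometric sequence; the limit is identified by Fatou's lemma.\<close>

lemma L2_complete:
  fixes f :: "nat \<Rightarrow> point \<Rightarrow> 'b::euclidean_space"
  assumes f: "\<And>n. f n \<in> L2 \<Omega>"
    and cauchy: "\<And>n m. n \<le> m \<Longrightarrow>
      l2_inner \<Omega> (\<lambda>x. f m x - f n x) (\<lambda>x. f m x - f n x) \<le> K * (1/4)^n"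
  obtains F where "F \<in> L2 \<Omega>" "(\<lambda>n. l2_inner \<Omega> (\<lambda>x. f n x - F x) (\<lambda>x. f n x - F x)) \<longlonglongrightarrow> 0"
proof -
  let ?M = "lebesgue_on \<Omega>"
  have [measurable]: "f n \<in> borel_measurable ?M" for n using f by (simp add: L2_iff)
  have K: "K \<ge> 0" using cauchy[of 0 0] l2_inner_nonneg[of \<Omega> "\<lambda>x. f 0 x - f 0 x"] by simp
  have bound: "(\<integral>\<^sup>+x. ennreal ((norm (f m x - f n x))\<^sup>2) \<partial>?M) \<le> ennreal (K * (1/4)^n)" if "n \<le> m" for n m
    using l2_normsq_eq_inner[OF L2_diff[OF f f]] cauchy[OF that]
    by (simp add: l2_normsq_def ennreal_leI)
  \<comment> \<open>The weight \<open>2^n\<close> splits the decay rate: the integrals of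
    \<open>h n\<close> are still at most \<open>K * (1/2)^n\<close>, hence summable, while
    boundedness of \<open>h n x\<close> in \<open>n\<close> makes the increments at \<open>x\<close>
    decay like powers of \<open>sqrt (1/2)\<close>.\<close>
  define h where "h n x = 2^n * (norm (f (Suc n) x - f n x))\<^sup>2" for n x
  have [measurable]: "h n \<in> borel_measurable ?M" for n unfolding h_def by measurable
  have h0: "h n x \<ge> 0" for n x by (simp add: h_def)
  have "(\<integral>\<^sup>+x. (\<Sum>n. ennreal (h n x)) \<partial>?M) = (\<Sum>n. \<integral>\<^sup>+x. ennreal (h n x) \<partial>?M)"
    by (intro nn_integral_suminf) measurable
  also have "\<dots> \<le> (\<Sum>n. ennreal (K * (1/2)^n))"
  proof (intro suminf_le summableI)
    fix n
    have "(\<integral>\<^sup>+x. ennreal (h n x) \<partial>?M) = ennreal (2^n) * (\<integral>\<^sup>+x. ennreal ((norm (f (Suc n) x - f n x))\<^sup>2) \<partial>?M)"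
      unfolding h_def by (subst nn_integral_cmult[symmetric]) (auto simp: ennreal_mult)
    also have "\<dots> \<le> ennreal (2^n) * ennreal (K * (1/4)^n)"
      by (intro mult_left_mono bound) auto
    also have "\<dots> = ennreal (K * (1/2)^n)"
      using K by (simp add: ennreal_mult[symmetric] power_divide power_mult_distrib[symmetric] field_simps)
    finally show "(\<integral>\<^sup>+x. ennreal (h n x) \<partial>?M) \<le> ennreal (K * (1/2)^n)" .
  qed
  also have "\<dots> < \<infinity>"
    using K by (subst suminf_ennreal2) (auto intro!: summable_mult summable_geometric)
  finally have "(\<integral>\<^sup>+x. (\<Sum>n. ennreal (h n x)) \<partial>?M) \<noteq> \<infinity>" by simp
  then have "AE x in ?M. (\<Sum>n. ennreal (h n x)) \<noteq> \<infinity>"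
    by (intro nn_integral_PInf_AE) auto
  then have ae: "AE x in ?M. convergent (\<lambda>n. f n x)"
  proof (rule AE_mp, intro AE_I2 impI)
    fix x assume "(\<Sum>n. ennreal (h n x)) \<noteq> \<infinity>"
    then have "summable (\<lambda>n. h n x)" using summable_suminf_not_top[of "\<lambda>n. h n x"] h0 by auto
    then have "(\<lambda>n. h n x) \<longlonglongrightarrow> 0" by (rule summable_LIMSEQ_zero)
    then have "Bseq (\<lambda>n. h n x)" by (intro convergent_imp_Bseq convergentI)
    then obtain C where C: "C > 0" "\<And>n. norm (h n x) \<le> C" by (auto simp: Bseq_def)
    have le: "norm (f (Suc n) x - f n x) \<le> sqrt C * (sqrt (1/2))^n" for n
    proof -
      have "(norm (f (Suc n) x - f n x))\<^sup>2 \<le> C * (1/2)^n"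
        using C(2)[of n] h0[of n x] by (simp add: h_def field_simps)
      then have "norm (f (Suc n) x - f n x) \<le> sqrt (C * (1/2)^n)"
        by (rule real_le_rsqrt)
      also have "\<dots> = sqrt C * (sqrt (1/2))^n" by (simp only: real_sqrt_mult real_sqrt_power)
      finally show ?thesis .
    qed
    have "summable (\<lambda>n. sqrt C * (sqrt (1/2))^n)"
      by (intro summable_mult summable_geometric) auto
    then have "summable (\<lambda>n. f (Suc n) x - f n x)"
      by (rule summable_comparison_test'[where N=0]) (use le in auto)
    then have "convergent (\<lambda>n. \<Sum>i<n. f (Suc i) x - f i x)" by (simp add: summable_iff_convergent)
    then have "convergent (\<lambda>n. f n x - f 0 x)"
      by (simp add: sum_lessThan_telescope[of "\<lambda>n. f n x"])
    then show "convergent (\<lambda>n. f n x)" 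
      using convergent_add[OF _ convergent_const[of "f 0 x"]] by fastforce
  qed
  define F where "F x = lim (\<lambda>n. f n x)" for x
  have [measurable]: "F \<in> borel_measurable ?M" unfolding F_def by measurable
  have lim: "AE x in ?M. (\<lambda>n. f n x) \<longlonglongrightarrow> F x"
    using ae by eventually_elim (simp add: F_def convergent_LIMSEQ_iff)
  \<comment> \<open>Fatou's lemma in \<open>m\<close> with \<open>n\<close> fixed. The estimate both
    puts \<open>F - f n\<close> into \<open>L2 \<Omega>\<close> and gives the rate of
    convergence.\<close>
  have fatou: "(\<integral>\<^sup>+x. ennreal ((norm (F x - f n x))\<^sup>2) \<partial>?M) \<le> ennreal (K * (1/4)^n)" for n
  proof -
    have "(\<integral>\<^sup>+x. ennreal ((norm (F x - f n x))\<^sup>2) \<partial>?M) =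
      (\<integral>\<^sup>+x. liminf (\<lambda>m. ennreal ((norm (f m x - f n x))\<^sup>2)) \<partial>?M)"
    proof (rule nn_integral_cong_AE, use lim in eventually_elim)
      fix x assume "(\<lambda>n. f n x) \<longlonglongrightarrow> F x"
      then have "(\<lambda>m. ennreal ((norm (f m x - f n x))\<^sup>2)) \<longlonglongrightarrow> ennreal ((norm (F x - f n x))\<^sup>2)"
        by (intro tendsto_intros)
      then show "ennreal ((norm (F x - f n x))\<^sup>2) = liminf (\<lambda>m. ennreal ((norm (f m x - f n x))\<^sup>2))"
        by (intro lim_imp_Liminf[symmetric]) auto
    qed
    also have "\<dots> \<le> liminf (\<lambda>m. \<integral>\<^sup>+x. ennreal ((norm (f m x - f n x))\<^sup>2) \<partial>?M)"
      by (intro nn_integral_liminf) measurable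
    also have "\<dots> \<le> ennreal (K * (1/4)^n)"
      using bound by (intro Liminf_le) (auto simp: eventually_sequentially)
    finally show ?thesis .
  qed
  have d: "(\<lambda>x. F x - f n x) \<in> L2 \<Omega>" for n
    using fatou[of n] by (auto simp: L2_def l2_normsq_def intro: le_less_trans)
  have le: "l2_inner \<Omega> (\<lambda>x. f n x - F x) (\<lambda>x. f n x - F x) \<le> K * (1/4)^n" for n
  proof -
    have "l2_inner \<Omega> (\<lambda>x. F x - f n x) (\<lambda>x. F x - f n x) \<le> K * (1/4)^n"
      using fatou[of n] l2_normsq_eq_inner[OF d] K by (simp add: l2_normsq_def ennreal_le_iff)
    then show ?thesis by (simp add: l2_inner_def algebra_simps)
  qed
  show thesis
  proof (rule that)
    show "F \<in> L2 \<Omega>" using L2_add[OF d f, of 0 0] by simp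
    have "(\<lambda>n. K * (1/4)^n) \<longlonglongrightarrow> 0" by (intro tendsto_mult_right_zero LIMSEQ_power_zero) simp
    from tendsto_sandwich[OF _ _ tendsto_const this]
    show "(\<lambda>n. l2_inner \<Omega> (\<lambda>x. f n x - F x) (\<lambda>x. f n x - F x)) \<longlonglongrightarrow> 0"
      by (auto intro!: always_eventually simp: l2_inner_nonneg le)
  qed
qed

section \<open>Test functions\<close>

lemma smooth_differentiable: "smooth f \<Longrightarrow> foldr pderiv_at is f differentiable at x"
  by (simp add: smooth_def differentiable_on_def)

lemma smooth_has_derivative:
  "smooth f \<Longrightarrow> (foldr pderiv_at is f has_derivative frechet_derivative (foldr pderiv_at is f) (at x)) (at x)"
  using smooth_differentiable by (simp add: frechet_derivative_works)

text \<open>Stated for lists of directions because \<open>smooth\<close> quantifies over them, and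
  as an equality of functions because the inductive step differentiates it once more.\<close>

lemma foldr_pderiv_bounded_linear:
  assumes "bounded_linear T" "smooth f"
  shows "foldr pderiv_at is (\<lambda>x. T (f x)) = (\<lambda>x. T (foldr pderiv_at is f x))"
proof (induction "is")
  case (Cons i "is")
  show ?case
  proof
    fix x
    from frechet_derivative_at[OF bounded_linear.has_derivative[OF assms(1) smooth_has_derivative[OF assms(2), of "is" x]]]
    show "foldr pderiv_at (i # is) (\<lambda>x. T (f x)) x = T (foldr pderiv_at (i # is) f x)"
      by (simp add: Cons pderiv_at_def[of i _ x] fun_eq_iff)
  qed
qed simp

lemma foldr_pderiv_lincomb:
  assumes "smooth f" "smooth g"
  shows "foldr pderiv_at is (\<lambda>x. s *\<^sub>R f x + t *\<^sub>R g x) =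
    (\<lambda>x. s *\<^sub>R foldr pderiv_at is f x + t *\<^sub>R foldr pderiv_at is g x)"
proof (induction "is")
  case (Cons i "is")
  show ?case
  proof
    fix x
    from frechet_derivative_at[OF has_derivative_add[OF
        has_derivative_scaleR_right[OF smooth_has_derivative[OF assms(1), of "is" x], of s]
        has_derivative_scaleR_right[OF smooth_has_derivative[OF assms(2), of "is" x], of t]]]
    show "foldr pderiv_at (i # is) (\<lambda>x. s *\<^sub>R f x + t *\<^sub>R g x) x =
        s *\<^sub>R foldr pderiv_at (i # is) f x + t *\<^sub>R foldr pderiv_at (i # is) g x"
      by (simp add: Cons pderiv_at_def[of i _ x] fun_eq_iff)
  qed
qed simp

lemma smooth_bounded_linear:
  assumes "bounded_linear T" "smooth f"
  shows "smooth (\<lambda>x. T (f x))"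
  unfolding smooth_def foldr_pderiv_bounded_linear[OF assms] differentiable_on_def
  using bounded_linear.has_derivative[OF assms(1) smooth_has_derivative[OF assms(2)]]
  by (auto intro: differentiableI)

lemma smooth_lincomb:
  assumes "smooth f" "smooth g"
  shows "smooth (\<lambda>x. s *\<^sub>R f x + t *\<^sub>R g x)"
  using assms
  by (auto simp: smooth_def foldr_pderiv_lincomb[OF assms] differentiable_on_def)

lemma smooth_pderiv:
  assumes "smooth f"
  shows "smooth (pderiv_at i f)"
  unfolding smooth_def
proof
  fix "is"
  \<comment> \<open>\<open>foldr\<close> applies the last list entry first, so differentiating
    \<open>f\<close> beforehand amounts to appending \<open>i\<close>.\<close>
  have "foldr pderiv_at is (pderiv_at i f) = foldr pderiv_at (is @ [i]) f" by simp
  then show "foldr pderiv_at is (pderiv_at i f) differentiable_on UNIV"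
    using assms unfolding smooth_def by metis
qed

lemma pderiv_at_bounded_linear:
  assumes "bounded_linear T" "smooth f"
  shows "pderiv_at i (\<lambda>x. T (f x)) x = T (pderiv_at i f x)"
  using foldr_pderiv_bounded_linear[OF assms, of "[i]"] by (simp add: fun_eq_iff)

lemma smooth_continuous: "smooth f \<Longrightarrow> continuous_on UNIV f"
  using smooth_differentiable[of f "[]"]
  by (auto intro!: continuous_at_imp_continuous_on differentiable_imp_continuous_within)

lemma test_functions_smooth: "\<phi> \<in> test_functions \<Omega> \<Longrightarrow> smooth \<phi>"
  by (simp add: test_functions_def)

lemma test_functions_supp:
  assumes "\<phi> \<in> test_functions \<Omega>"
  shows "compact (closure {x. \<phi> x \<noteq> 0})" "closure {x. \<phi> x \<noteq> 0} \<subseteq> \<Omega>"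
  using assms by (auto simp: test_functions_def)

text \<open>The exact support of a sum or a linear image is awkward; a compact superset inside
  \<open>\<Omega>\<close> is enough, since the support is then a closed part of it.\<close>

lemma test_functionsI:
  assumes "smooth \<phi>" "compact K" "K \<subseteq> \<Omega>" "\<And>x. x \<notin> K \<Longrightarrow> \<phi> x = 0"
  shows "\<phi> \<in> test_functions \<Omega>"
proof -
  have "closure {x. \<phi> x \<noteq> 0} \<subseteq> K"
    using assms by (intro closure_minimal compact_imp_closed) auto
  then show ?thesis
    using assms compact_Int_closed[OF assms(2) closed_closure[of "{x. \<phi> x \<noteq> 0}"]]
    by (auto simp: test_functions_def Int_absorb1)
qed

lemma test_functions_bounded_linear:
  assumes "bounded_linear T" "\<phi> \<in> test_functions \<Omega>"
  shows "(\<lambda>x. T (\<phi> x)) \<in> test_functions \<Omega>"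
  using smooth_bounded_linear[OF assms(1) test_functions_smooth[OF assms(2)]]
    test_functions_supp[OF assms(2)]
proof (rule test_functionsI)
  show "T (\<phi> x) = 0" if "x \<notin> closure {x. \<phi> x \<noteq> 0}" for x
    using linear_0[OF bounded_linear.linear[OF assms(1)]] by (simp only: closure_supp_zero[OF that])
qed

lemma test_functions_pderiv:
  assumes "\<phi> \<in> test_functions \<Omega>"
  shows "pderiv_at i \<phi> \<in> test_functions \<Omega>"
  using smooth_pderiv[OF test_functions_smooth[OF assms]] test_functions_supp[OF assms] pderiv_at_eq_zero
  by (rule test_functionsI)

lemma test_functions_lincomb:
  assumes "\<phi> \<in> test_functions \<Omega>" "\<psi> \<in> test_functions \<Omega>"
  shows "(\<lambda>x. s *\<^sub>R \<phi> x + t *\<^sub>R \<psi> x) \<in> test_functions \<Omega>"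
proof (rule test_functionsI)
  let ?K = "closure {x. \<phi> x \<noteq> 0} \<union> closure {x. \<psi> x \<noteq> 0}"
  show "smooth (\<lambda>x. s *\<^sub>R \<phi> x + t *\<^sub>R \<psi> x)"
    using assms by (intro smooth_lincomb test_functions_smooth)
  show "compact ?K" "?K \<subseteq> \<Omega>" using test_functions_supp[OF assms(1)] test_functions_supp[OF assms(2)] by auto
  show "s *\<^sub>R \<phi> x + t *\<^sub>R \<psi> x = 0" if "x \<notin> ?K" for x
    using that closure_supp_zero[of x \<phi>] closure_supp_zero[of x \<psi>] by auto
qed

lemma test_functions_zero: "(\<lambda>_. 0) \<in> test_functions \<Omega>"
proof (rule test_functionsI[where K="{}"])
  have "foldr pderiv_at is (\<lambda>_. 0 :: 'a) = (\<lambda>_. 0)" for "is"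
  proof (induction "is")
    case (Cons i "is")
    have "pderiv_at i (\<lambda>_. 0 :: 'a) = (\<lambda>_. 0)" by (simp add: fun_eq_iff pderiv_at_def[of i _ "_ :: point"] frechet_derivative_const)
    with Cons show ?case by simp
  qed simp
  then show "smooth (\<lambda>_. 0 :: 'a)" by (simp add: smooth_def)
qed auto

lemma test_functions_C1c:
  assumes "\<phi> \<in> test_functions \<Omega>"
  shows "C1c \<phi>"
  using smooth_differentiable[OF test_functions_smooth[OF assms], of "[]"] test_functions_supp(1)[OF assms]
    smooth_continuous[OF smooth_pderiv[OF test_functions_smooth[OF assms]]]
  by (simp add: C1c_def)

lemma pderiv_at_nth: "\<phi> \<in> test_functions \<Omega> \<Longrightarrow> pderiv_at i (\<lambda>x. \<phi> x $ j) x = pderiv_at i \<phi> x $ j"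
  by (rule pderiv_at_bounded_linear[OF bounded_linear_vec_nth test_functions_smooth])

lemma jacobian_nth: "jacobian \<phi> (at x) $ j $ i = pderiv_at i \<phi> x $ j"
  by (simp add: jacobian_def matrix_def pderiv_at_def)

lemma jacobian_lincomb:
  assumes "\<phi> \<in> test_functions \<Omega>" "\<psi> \<in> test_functions \<Omega>"
  shows "jacobian (\<lambda>x. s *\<^sub>R \<phi> x + t *\<^sub>R \<psi> x) (at x) = s *\<^sub>R jacobian \<phi> (at x) + t *\<^sub>R jacobian \<psi> (at x)"
proof -
  have "pderiv_at i (\<lambda>x. s *\<^sub>R \<phi> x + t *\<^sub>R \<psi> x) x = s *\<^sub>R pderiv_at i \<phi> x + t *\<^sub>R pderiv_at i \<psi> x" for i
    using foldr_pderiv_lincomb[OF assms[THEN test_functions_smooth], of "[i]" s t] by (simp add: fun_eq_iff)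
  then show ?thesis by (simp add: vec_eq_iff jacobian_nth)
qed

section \<open>From whole-space \<open>lborel\<close> integrals to
  \<open>lebesgue_on \<Omega>\<close>\<close>

lemma integrable_lborel_imp_lebesgue_on:
  fixes f :: "point \<Rightarrow> 'b::euclidean_space"
  assumes "integrable lborel f" "\<Omega> \<in> sets lebesgue"
  shows "integrable (lebesgue_on \<Omega>) f"
proof -
  have "integrable lebesgue f"
    using assms by (subst integrable_completion) auto
  then show ?thesis
    using assms by (simp add: integrable_restrict_space integrable_mult_indicator)
qed

text \<open>Integration by parts was proved on the whole space, where translations act, whereas the
  norms live on \<open>\<Omega>\<close>. This bridges the two for functions vanishing off
  \<open>\<Omega>\<close>.\<close>

lemma integral_lebesgue_on_eq_lborel:
  fixes f :: "point \<Rightarrow> 'b::euclidean_space"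
  assumes "f \<in> borel_measurable borel" "\<Omega> \<in> sets lebesgue" "\<And>x. x \<notin> \<Omega> \<Longrightarrow> f x = 0"
  shows "(\<integral>x. f x \<partial>lebesgue_on \<Omega>) = (\<integral>x. f x \<partial>lborel)"
proof -
  have "(\<integral>x. f x \<partial>lebesgue_on \<Omega>) = (\<integral>x. indicator \<Omega> x *\<^sub>R f x \<partial>lebesgue)"
    using assms by (simp add: integral_restrict_space)
  also have "\<dots> = (\<integral>x. f x \<partial>lebesgue)"
    using assms(3) by (intro Bochner_Integration.integral_cong) (auto simp: indicator_def)
  also have "\<dots> = (\<integral>x. f x \<partial>lborel)"
    using assms by (subst integral_completion) auto
  finally show ?thesis .
qed

lemma L2_compact_supp:
  fixes f :: "point \<Rightarrow> 'b::euclidean_space"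
  assumes "continuous_on UNIV f" "compact K" "\<And>x. x \<notin> K \<Longrightarrow> f x = 0" "\<Omega> \<in> sets lebesgue"
  shows "f \<in> L2 \<Omega>"
  unfolding L2_iff
proof
  show "f \<in> borel_measurable (lebesgue_on \<Omega>)"
    using integrable_lborel_imp_lebesgue_on[OF integrable_compact_supp[OF assms(1-3)] assms(4)] by auto
  have "integrable lborel (\<lambda>x. (norm (f x))\<^sup>2)"
    using assms by (intro integrable_compact_supp[where K=K]) (auto intro!: continuous_intros)
  then show "integrable (lebesgue_on \<Omega>) (\<lambda>x. (norm (f x))\<^sup>2)"
    using assms(4) by (rule integrable_lborel_imp_lebesgue_on)
qed

lemma test_functions_L2:
  assumes "\<phi> \<in> test_functions \<Omega>" "\<Omega> \<in> sets lebesgue"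
  shows "\<phi> \<in> L2 \<Omega>"
  using smooth_continuous[OF test_functions_smooth[OF assms(1)]] test_functions_supp(1)[OF assms(1)]
    closure_supp_zero[where f=\<phi>] assms(2)
  by (rule L2_compact_supp)

lemma L2_vec:
  fixes f :: "point \<Rightarrow> 'b::euclidean_space ^ 'n"
  assumes "\<And>i. (\<lambda>x. f x $ i) \<in> L2 \<Omega>"
  shows "f \<in> L2 \<Omega>"
proof -
  have m: "(\<lambda>x. f x $ i) \<in> borel_measurable (lebesgue_on \<Omega>)" for i using assms by (rule L2_measurable)
  have "f \<in> borel_measurable (lebesgue_on \<Omega>)"
    unfolding borel_measurable_euclidean_space[of f]
  proof
    fix b :: "'b ^ 'n" assume "b \<in> Basis"
    have "(\<lambda>x. f x \<bullet> b) = (\<lambda>x. \<Sum>i\<in>UNIV. f x $ i \<bullet> b $ i)" by (simp add: inner_vec_def)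
    then show "(\<lambda>x. f x \<bullet> b) \<in> borel_measurable (lebesgue_on \<Omega>)"
      using m by simp
  qed
  moreover have "(\<lambda>x. (norm (f x))\<^sup>2) = (\<lambda>x. \<Sum>i\<in>UNIV. (norm (f x $ i))\<^sup>2)"
    by (auto simp: norm_vec_def L2_set_def sum_nonneg)
  ultimately show ?thesis using assms by (simp add: L2_iff)
qed

lemma L2_nth: "f \<in> L2 \<Omega> \<Longrightarrow> (\<lambda>x. f x $ i) \<in> L2 \<Omega>"
  for f :: "point \<Rightarrow> 'b::euclidean_space ^ 'n"
  by (rule L2_bounded_linear[OF bounded_linear_vec_nth])

lemma jacobian_L2:
  assumes "\<phi> \<in> test_functions \<Omega>" "\<Omega> \<in> sets lebesgue"
  shows "(\<lambda>x. jacobian \<phi> (at x)) \<in> L2 \<Omega>"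
  using assms by (intro L2_vec) (simp add: jacobian_nth L2_nth test_functions_L2 test_functions_pderiv)

lemma l2_inner_lborel:
  fixes f g :: "point \<Rightarrow> real"
  assumes "f \<in> test_functions \<Omega>" "g \<in> test_functions \<Omega>" "\<Omega> \<in> sets lebesgue"
  shows "l2_inner \<Omega> f g = (\<integral>x. f x * g x \<partial>lborel)"
proof -
  have "f x * g x = 0" if "x \<notin> \<Omega>" for x
    using closure_supp_zero[of x f] test_functions_supp(2)[OF assms(1)] that by auto
  moreover have "(\<lambda>x. f x * g x) \<in> borel_measurable borel"
    using assms(1,2)[THEN test_functions_smooth, THEN smooth_continuous]
    by (intro borel_measurable_continuous_onI continuous_intros)
  ultimately show ?thesis
    using assms(3) by (simp add: l2_inner_def integral_lebesgue_on_eq_lborel)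
qed

lemma l2_inner_pderiv_swap:
  fixes f g :: "point \<Rightarrow> real"
  assumes "f \<in> test_functions \<Omega>" "g \<in> test_functions \<Omega>" "\<Omega> \<in> sets lebesgue"
  shows "l2_inner \<Omega> (pderiv_at i f) (pderiv_at j g) = l2_inner \<Omega> (pderiv_at j f) (pderiv_at i g)"
  using assms integral_pderiv_swap[of f g i j]
  by (simp add: l2_inner_lborel test_functions_pderiv test_functions_C1c)

lemma l2_inner_by_parts:
  fixes f g :: "point \<Rightarrow> real"
  assumes "f \<in> test_functions \<Omega>" "g \<in> test_functions \<Omega>" "\<Omega> \<in> sets lebesgue"
  shows "l2_inner \<Omega> (pderiv_at i f) g = - l2_inner \<Omega> f (pderiv_at i g)"
  using assms integration_by_parts[of f g i]
  by (simp add: l2_inner_lborel test_functions_pderiv test_functions_C1c mult.commute)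

lemma L2_scaleR_integrable:
  assumes "\<eta> \<in> L2 \<Omega>" "f \<in> L2 \<Omega>"
  shows "integrable (lebesgue_on \<Omega>) (\<lambda>x. \<eta> x *\<^sub>R f x)"
proof (rule Bochner_Integration.integrable_bound)
  show "integrable (lebesgue_on \<Omega>) (\<lambda>x. norm (\<eta> x) \<bullet> norm (f x))"
    using assms by (intro L2_inner_integrable) (auto simp: L2_iff)
  show "(\<lambda>x. \<eta> x *\<^sub>R f x) \<in> borel_measurable (lebesgue_on \<Omega>)"
    using assms by (auto simp: L2_iff)
qed auto

lemma distr_real:
  fixes f :: "point \<Rightarrow> real"
  shows "distr \<Omega> f \<eta> = l2_inner \<Omega> \<eta> f"
  by (simp add: distr_def l2_inner_def)

text \<open>Integrability of the vector integrand has to come first: otherwise its integral is the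
  default value 0, although a single component may still be integrable.\<close>

lemma distr_nth:
  fixes f :: "point \<Rightarrow> 'b::euclidean_space ^ 'n"
  assumes "\<eta> \<in> L2 \<Omega>" "f \<in> L2 \<Omega>"
  shows "distr \<Omega> f \<eta> $ k = distr \<Omega> (\<lambda>x. f x $ k) \<eta>"
  using integral_bounded_linear[OF bounded_linear_vec_nth L2_scaleR_integrable[OF assms]]
  by (simp add: distr_def)

section \<open>Weak solution of the vector Laplace equation\<close>

text \<open>Dirichlet's principle on a space that may be incomplete: \<open>b\<close> is the cross
  term of the quadratic form \<open>a\<close>, and near-minimizers of the energy \<open>J\<close>
  are Cauchy with respect to \<open>a\<close>. The weak equation for \<open>l\<close> appears as the
  limit of the first variation, without a minimizer in \<open>V\<close>.\<close>

lemma minimizing_sequence: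
  fixes V :: "('p \<Rightarrow> 'b::real_vector) set" and a l :: "('p \<Rightarrow> 'b) \<Rightarrow> real" and b :: "('p \<Rightarrow> 'b) \<Rightarrow> ('p \<Rightarrow> 'b) \<Rightarrow> real"
  assumes V: "V \<noteq> {}" "\<And>s t f g. f \<in> V \<Longrightarrow> g \<in> V \<Longrightarrow> (\<lambda>x. s *\<^sub>R f x + t *\<^sub>R g x) \<in> V"
    and a: "\<And>s t f g. f \<in> V \<Longrightarrow> g \<in> V \<Longrightarrow>
      a (\<lambda>x. s *\<^sub>R f x + t *\<^sub>R g x) = s\<^sup>2 * a f + 2 * s * t * b f g + t\<^sup>2 * a g"
    and l: "\<And>s t f g. f \<in> V \<Longrightarrow> g \<in> V \<Longrightarrow> l (\<lambda>x. s *\<^sub>R f x + t *\<^sub>R g x) = s * l f + t * l g"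
    and a_nonneg: "\<And>f. f \<in> V \<Longrightarrow> 0 \<le> a f"
    and l_bound: "\<And>f. f \<in> V \<Longrightarrow> (l f)\<^sup>2 \<le> C * a f" and C: "0 \<le> C"
  obtains \<phi> :: "nat \<Rightarrow> 'p \<Rightarrow> 'b" where "\<And>n. \<phi> n \<in> V"
    and "\<And>n m. n \<le> m \<Longrightarrow> a (\<lambda>x. \<phi> m x - \<phi> n x) \<le> 4 * (1/4)^n"
    and "\<And>\<psi>. \<psi> \<in> V \<Longrightarrow> (\<lambda>n. b (\<phi> n) \<psi>) \<longlonglongrightarrow> l \<psi>"
proof -
  define J where "J f = a f - 2 * l f" for f
  define m where "m = Inf (J ` V)"
  \<comment> \<open>From \<open>4 * C * a f \<le> (a f + C)^2\<close> it follows that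
    \<open>2 * l f \<le> a f + C\<close>.\<close>
  have "- C \<le> J f" if "f \<in> V" for f
  proof -
    have "(2 * l f)\<^sup>2 \<le> 4 * (C * a f)" using l_bound[OF that] by (simp add: power_mult_distrib)
    also have "\<dots> \<le> (a f + C)\<^sup>2"
      using zero_le_power2[of "a f - C"] by (simp add: power2_eq_square algebra_simps)
    finally have "2 * l f \<le> a f + C"
      using a_nonneg[OF that] C by (intro power2_le_imp_le[of "2 * l f" "a f + C"]) simp_all
    then show ?thesis by (simp add: J_def)
  qed
  then have bdd: "bdd_below (J ` V)" by (intro bdd_belowI2)
  have m_le: "m \<le> J f" if "f \<in> V" for f
    unfolding m_def using that bdd by (intro cInf_lower) auto
  \<comment> \<open>The excess \<open>(1/4)^n\<close> over the infimum is chosen to match the rate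
    required by \<open>L2_complete\<close>.\<close>
  have "\<exists>f. f \<in> V \<and> J f < m + (1/4)^n" for n :: nat
  proof -
    have "Inf (J ` V) < m + (1/4)^n" by (simp add: m_def)
    from cInf_lessD[OF _ this] V(1) show ?thesis by blast
  qed
  then obtain \<phi> where \<phi>: "\<And>n. \<phi> n \<in> V" "\<And>n::nat. J (\<phi> n) < m + (1/4)^n"
    using choice[of "\<lambda>n f. f \<in> V \<and> J f < m + (1/4)^n"] by blast
  show thesis
  proof (rule that[of \<phi>])
    show "\<phi> n \<in> V" for n by (rule \<phi>)
  next
    fix i j :: nat assume "i \<le> j"
    let ?f = "\<phi> j" and ?g = "\<phi> i"
    \<comment> \<open>The midpoint is the competitor. Multiplied by 4, this inequality bounds
      \<open>a\<close> of the difference by twice the sum of the two excesses of \<open>J\<close>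
      over \<open>m\<close>.\<close>
    have "m \<le> J (\<lambda>x. (1/2) *\<^sub>R ?f x + (1/2) *\<^sub>R ?g x)" by (rule m_le[OF V(2)[OF \<phi>(1) \<phi>(1)]])
    also have "\<dots> = 1/4 * a ?f + 1/2 * b ?f ?g + 1/4 * a ?g - l ?f - l ?g"
      unfolding J_def
      using a[OF \<phi>(1) \<phi>(1), where s="1/2" and t="1/2"] l[OF \<phi>(1) \<phi>(1), where s="1/2" and t="1/2"]
      by (simp add: power2_eq_square)
    finally have mid: "m \<le> 1/4 * a ?f + 1/2 * b ?f ?g + 1/4 * a ?g - l ?f - l ?g" .
    have "a (\<lambda>x. ?f x - ?g x) = a ?f - 2 * b ?f ?g + a ?g"
      using a[OF \<phi>(1) \<phi>(1), where s=1 and t="-1"] by simp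
    also have "\<dots> \<le> 2 * (J ?f - m) + 2 * (J ?g - m)"
      using mid unfolding J_def by (simp add: algebra_simps)
    also have "\<dots> \<le> 2 * (1/4)^j + 2 * (1/4)^i"
      by (intro add_mono mult_left_mono) (use \<phi>(2)[of i] \<phi>(2)[of j] in \<open>simp_all add: less_imp_le diff_le_eq add.commute\<close>)
    also have "\<dots> \<le> 4 * (1/4)^i"
      using power_decreasing[OF \<open>i \<le> j\<close>, of "1/4 :: real"] by simp
    finally show "a (\<lambda>x. ?f x - ?g x) \<le> 4 * (1/4)^i" .
  next
    fix \<psi> assume \<psi>: "\<psi> \<in> V"
    have le: "\<bar>b (\<phi> n) \<psi> - l \<psi>\<bar> \<le> sqrt (a \<psi> * (1/4)^n)" for n
    proof (rule real_le_rsqrt)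
      \<comment> \<open>Adding \<open>t\<close> times \<open>\<psi>\<close> to
        \<open>\<phi> n\<close> cannot push \<open>J\<close> below \<open>m\<close> for any
        \<open>t\<close>; the discriminant bounds the first variation by the excess of
        \<open>J (\<phi> n)\<close>.\<close>
      have "(b (\<phi> n) \<psi> - l \<psi>)\<^sup>2 \<le> a \<psi> * (J (\<phi> n) - m)"
      proof (rule quadratic_nonneg_imp)
        fix t :: real
        have "m \<le> J (\<lambda>x. 1 *\<^sub>R \<phi> n x + t *\<^sub>R \<psi> x)" by (rule m_le[OF V(2)[OF \<phi>(1) \<psi>]])
        also have "\<dots> = J (\<phi> n) + 2 * t * (b (\<phi> n) \<psi> - l \<psi>) + t\<^sup>2 * a \<psi>"
          unfolding J_def using a[OF \<phi>(1) \<psi>, where s=1 and t=t] l[OF \<phi>(1) \<psi>, where s=1 and t=t] by (simp add: algebra_simps)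
        finally show "0 \<le> J (\<phi> n) - m + 2 * t * (b (\<phi> n) \<psi> - l \<psi>) + t\<^sup>2 * a \<psi>" by simp
      qed (rule a_nonneg[OF \<psi>])
      also have "a \<psi> * (J (\<phi> n) - m) \<le> a \<psi> * (1/4)^n"
        using \<phi>(2)[of n] by (intro mult_left_mono a_nonneg[OF \<psi>]) simp
      finally show "\<bar>b (\<phi> n) \<psi> - l \<psi>\<bar>\<^sup>2 \<le> a \<psi> * (1/4)^n" by simp
    qed
    have "(\<lambda>n. sqrt (a \<psi> * (1/4)^n)) \<longlonglongrightarrow> sqrt 0"
      by (intro tendsto_real_sqrt tendsto_mult_right_zero LIMSEQ_power_zero) simp
    then have "(\<lambda>n. sqrt (a \<psi> * (1/4)^n)) \<longlonglongrightarrow> 0" by simp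
    moreover have "\<forall>\<^sub>F n in sequentially. norm (b (\<phi> n) \<psi> - l \<psi>) \<le> sqrt (a \<psi> * (1/4)^n)"
      using le by (simp only: real_norm_def always_eventually simp_thms)
    ultimately have "(\<lambda>n. b (\<phi> n) \<psi> - l \<psi>) \<longlonglongrightarrow> 0"
      by (rule Lim_null_comparison[rotated])
    then show "(\<lambda>n. b (\<phi> n) \<psi>) \<longlonglongrightarrow> l \<psi>" by (simp add: LIM_zero_iff)
  qed
qed

section \<open>Curl and trace as linear functions of a matrix\<close>

text \<open>Row \<open>j\<close>, column \<open>i\<close> stands for the derivative of component
  \<open>j\<close> in direction \<open>i\<close>. Defined on matrices, the curl also makes sense for
  an \<open>L2\<close> limit of Jacobians that is not itself given as a Jacobian.\<close>

definition curl_of_jacobian :: "real ^ 3 ^ 3 \<Rightarrow> real ^ 3" where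
  "curl_of_jacobian A = vector [A $ 3 $ 2 - A $ 2 $ 3, A $ 1 $ 3 - A $ 3 $ 1, A $ 2 $ 1 - A $ 1 $ 2]"

lemma curl_of_jacobian_nth [simp]:
  "curl_of_jacobian A $ 1 = A $ 3 $ 2 - A $ 2 $ 3"
  "curl_of_jacobian A $ 2 = A $ 1 $ 3 - A $ 3 $ 1"
  "curl_of_jacobian A $ 3 = A $ 2 $ 1 - A $ 1 $ 2"
  by (simp_all add: curl_of_jacobian_def)

lemma bounded_linear_curl_of_jacobian: "bounded_linear curl_of_jacobian"
  unfolding linear_conv_bounded_linear[symmetric]
  by (rule linearI) (simp_all add: vec_eq_iff forall_3 algebra_simps)

lemma bounded_linear_trace: "bounded_linear (trace :: real ^ 3 ^ 3 \<Rightarrow> real)"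
  unfolding linear_conv_bounded_linear[symmetric]
  by (rule linearI) (simp_all add: trace_def sum_3 algebra_simps)

text \<open>Pointwise form of the splitting of the gradient norm into divergence and curl. The three
  remaining brackets are negated principal 2 by 2 minors, which integrate to zero for limits of
  Jacobians of test fields.\<close>

lemma trace_curl_decomposition:
  "A \<bullet> A = trace A * trace A + curl_of_jacobian A \<bullet> curl_of_jacobian A
     + 2 * (A$1$2 * A$2$1 - A$1$1 * A$2$2) + 2 * (A$1$3 * A$3$1 - A$1$1 * A$3$3)
     + 2 * (A$2$3 * A$3$2 - A$2$2 * A$3$3)"
  by (simp add: inner_vec_def trace_def sum_3 algebra_simps)

lemma open_imp_sets_lebesgue: "open \<Omega> \<Longrightarrow> \<Omega> \<in> sets lebesgue" for \<Omega> :: "point set"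
  by (simp add: sets_completionI_sets)

section \<open>Distributional derivatives in components and the kernel of \<open>rot\<close>\<close>

lemma distr_pderiv_nth:
  fixes f :: "point \<Rightarrow> real ^ 3"
  assumes "open \<Omega>" "\<eta> \<in> test_functions \<Omega>" "f \<in> L2 \<Omega>"
  shows "distr_pderiv i (distr \<Omega> f) \<eta> $ k = - l2_inner \<Omega> (pderiv_at i \<eta>) (\<lambda>x. f x $ k)"
  using assms
  by (simp add: distr_pderiv_def distr_nth distr_real test_functions_L2 test_functions_pderiv open_imp_sets_lebesgue)

text \<open>The minus sign in \<open>distr_pderiv\<close> reverses the differences in
  \<open>distr_rot\<close>.\<close>

lemma distr_rot_nth:
  fixes f :: "point \<Rightarrow> real ^ 3"
  assumes "open \<Omega>" "\<eta> \<in> test_functions \<Omega>" "f \<in> L2 \<Omega>"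
  shows "distr_rot (distr \<Omega> f) \<eta> $ 1 =
      l2_inner \<Omega> (pderiv_at 3 \<eta>) (\<lambda>x. f x $ 2) - l2_inner \<Omega> (pderiv_at 2 \<eta>) (\<lambda>x. f x $ 3)"
    and "distr_rot (distr \<Omega> f) \<eta> $ 2 =
      l2_inner \<Omega> (pderiv_at 1 \<eta>) (\<lambda>x. f x $ 3) - l2_inner \<Omega> (pderiv_at 3 \<eta>) (\<lambda>x. f x $ 1)"
    and "distr_rot (distr \<Omega> f) \<eta> $ 3 =
      l2_inner \<Omega> (pderiv_at 2 \<eta>) (\<lambda>x. f x $ 1) - l2_inner \<Omega> (pderiv_at 1 \<eta>) (\<lambda>x. f x $ 2)"
  by (simp_all add: distr_rot_def distr_pderiv_nth[OF assms])

lemma l2_inner_vec: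
  fixes f g :: "point \<Rightarrow> 'b::euclidean_space ^ 'n"
  assumes "f \<in> L2 \<Omega>" "g \<in> L2 \<Omega>"
  shows "l2_inner \<Omega> f g = (\<Sum>i\<in>UNIV. l2_inner \<Omega> (\<lambda>x. f x $ i) (\<lambda>x. g x $ i))"
  using assms
  by (simp add: l2_inner_def inner_vec_def Bochner_Integration.integral_sum L2_inner_integrable L2_nth)

text \<open>Tested against \<open>\<theta>\<close>, the curl of a gradient involves only products of
  first derivatives, and \<open>l2_inner_pderiv_swap\<close> cancels them in pairs. Orthogonality to
  these gradients will yield zero divergence.\<close>

lemma gradient_in_ker_rot:
  assumes "open \<Omega>" "\<eta> \<in> test_functions \<Omega>"
  shows "(\<lambda>x. \<chi> i. pderiv_at i \<eta> x) \<in> ker_rot \<Omega>"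
proof -
  have L2: "(\<lambda>x. \<chi> i. pderiv_at i \<eta> x) \<in> L2 \<Omega>"
    using assms by (intro L2_vec) (simp add: test_functions_L2 test_functions_pderiv open_imp_sets_lebesgue)
  have sw: "l2_inner \<Omega> (pderiv_at i \<theta>) (pderiv_at j \<eta>) = l2_inner \<Omega> (pderiv_at j \<theta>) (pderiv_at i \<eta>)"
    if "\<theta> \<in> test_functions \<Omega>" for \<theta> i j
    using that assms by (intro l2_inner_pderiv_swap open_imp_sets_lebesgue)
  have "distr_rot (distr \<Omega> (\<lambda>x. \<chi> i. pderiv_at i \<eta> x)) \<theta> = 0" if "\<theta> \<in> test_functions \<Omega>" for \<theta>
    using sw[OF that, of 1 2] sw[OF that, of 1 3] sw[OF that, of 2 3]
    by (simp add: vec_eq_iff forall_3 distr_rot_nth[OF assms(1) that L2])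
  with L2 show ?thesis by (simp add: ker_rot_def distr_eq_def)
qed

text \<open>Formal self-adjointness of \<open>rot\<close>: the inner product is the sum over
  \<open>k\<close> of component \<open>k\<close> of the distribution \<open>rot z\<close>, evaluated
  at component \<open>k\<close> of \<open>\<phi>\<close>.\<close>

lemma curl_test_function_orthogonal_ker_rot:
  assumes "open \<Omega>" "\<phi> \<in> test_functions \<Omega>" "z \<in> ker_rot \<Omega>"
  shows "l2_inner \<Omega> (\<lambda>x. curl_of_jacobian (jacobian \<phi> (at x))) z = 0"
proof -
  note m = open_imp_sets_lebesgue[OF assms(1)]
  have rot: "distr_rot (distr \<Omega> z) \<eta> = 0" if "\<eta> \<in> test_functions \<Omega>" for \<eta>
    using assms(3) that by (auto simp: ker_rot_def distr_eq_def)
  have comp: "(\<lambda>x. \<phi> x $ k) \<in> test_functions \<Omega>" for k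
    by (rule test_functions_bounded_linear[OF bounded_linear_vec_nth assms(2)])
  have z: "z \<in> L2 \<Omega>" using assms(3) by (simp add: ker_rot_def)
  have J: "(\<lambda>x. jacobian \<phi> (at x)) \<in> L2 \<Omega>" by (rule jacobian_L2[OF assms(2) m])
  have e: "jacobian \<phi> (at x) $ k $ i = pderiv_at i (\<lambda>x. \<phi> x $ k) x" for i k x
    using pderiv_at_nth[OF assms(2)] by (simp add: jacobian_nth)
  have d: "pderiv_at i (\<lambda>x. \<phi> x $ k) \<in> L2 \<Omega>" for i k
    using comp m by (simp add: test_functions_L2 test_functions_pderiv)
  have "l2_inner \<Omega> (\<lambda>x. curl_of_jacobian (jacobian \<phi> (at x))) z =
      distr_rot (distr \<Omega> z) (\<lambda>x. \<phi> x $ 1) $ 1 + distr_rot (distr \<Omega> z) (\<lambda>x. \<phi> x $ 2) $ 2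
      + distr_rot (distr \<Omega> z) (\<lambda>x. \<phi> x $ 3) $ 3"
    using L2_bounded_linear[OF bounded_linear_curl_of_jacobian J] z d
    by (simp add: l2_inner_vec sum_3 distr_rot_nth[OF assms(1) comp z] e l2_inner_diff_left L2_nth)
  then show ?thesis using rot comp by simp
qed

text \<open>Integration by parts identifies the classical Jacobian with the distributional one, so
  that Hardy's inequality can be applied to test fields.\<close>

lemma has_L2_gradient_test_function:
  assumes "open \<Omega>" "\<phi> \<in> test_functions \<Omega>"
  shows "has_L2_gradient \<Omega> \<phi> (\<lambda>x. jacobian \<phi> (at x))"
proof -
  note m = open_imp_sets_lebesgue[OF assms(1)]
  have J: "(\<lambda>x. jacobian \<phi> (at x)) \<in> L2 \<Omega>" by (rule jacobian_L2[OF assms(2) m])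
  have comp: "(\<lambda>x. \<phi> x $ k) \<in> test_functions \<Omega>" for k
    by (rule test_functions_bounded_linear[OF bounded_linear_vec_nth assms(2)])
  have e: "jacobian \<phi> (at x) $ k $ i = pderiv_at i (\<lambda>x. \<phi> x $ k) x" for i k x
    using pderiv_at_nth[OF assms(2)] by (simp add: jacobian_nth)
  have "distr_jacobian (distr \<Omega> \<phi>) \<eta> = distr \<Omega> (\<lambda>x. jacobian \<phi> (at x)) \<eta>"
    if \<eta>: "\<eta> \<in> test_functions \<Omega>" for \<eta>
    using l2_inner_by_parts[OF \<eta> comp m] J
    by (simp add: vec_eq_iff distr_jacobian_def distr_pderiv_nth[OF assms(1) \<eta> test_functions_L2[OF assms(2) m]]
        distr_nth test_functions_L2[OF \<eta> m] L2_nth distr_real e)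
  with J show ?thesis by (simp add: has_L2_gradient_def distr_eq_def)
qed

section \<open>Hardy's inequality as a bound for the pairing with \<open>w\<close>\<close>

lemma test_functions_H10:
  assumes "open \<Omega>" "\<phi> \<in> test_functions \<Omega>"
  shows "\<phi> \<in> H10 \<Omega>"
  unfolding H10_def
  using assms has_L2_gradient_test_function[OF assms] test_functions_L2[OF assms(2) open_imp_sets_lebesgue]
  by (auto simp: l2_normsq_def intro!: exI[of _ "\<lambda>x. jacobian \<phi> (at x)"] exI[of _ "\<lambda>_. \<phi>"])

text \<open>\<open>infdist\<close> to the empty set is 0, so the frontier must be shown nonempty:
  otherwise \<open>\<Omega>\<close> would be empty or the unbounded whole space. Openness keeps
  \<open>x\<close> off the closed frontier.\<close>

lemma bdist_pos:
  assumes "bounded_domain \<Omega>" "x \<in> \<Omega>"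
  shows "0 < bdist \<Omega> x"
proof -
  have "frontier \<Omega> \<noteq> {}"
    using assms frontier_eq_empty[of \<Omega>] not_bounded_UNIV by (auto simp: bounded_domain_def)
  moreover have "x \<notin> frontier \<Omega>"
    using assms by (auto simp: bounded_domain_def frontier_def interior_open)
  ultimately show ?thesis
    unfolding bdist_def using in_closed_iff_infdist_zero[OF frontier_closed] infdist_nonneg by (metis less_le)
qed

lemma nn_integral_lebesgue_on_mono:
  assumes "K \<subseteq> \<Omega>" "K \<in> sets lebesgue" "\<Omega> \<in> sets lebesgue"
  shows "(\<integral>\<^sup>+x. f x \<partial>lebesgue_on K) \<le> (\<integral>\<^sup>+x. f x \<partial>lebesgue_on \<Omega>)"
  using assms by (auto simp: nn_integral_restrict_space indicator_def intro!: nn_integral_mono)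

text \<open>On the compact support, \<open>w\<close> is integrable and \<open>\<phi>\<close> is
  bounded; the product vanishes elsewhere.\<close>

lemma integrable_test_function_locally_integrable:
  fixes \<phi> w :: "point \<Rightarrow> 'b::euclidean_space"
  assumes "open \<Omega>" "\<phi> \<in> test_functions \<Omega>" "locally_integrable \<Omega> w"
  shows "integrable (lebesgue_on \<Omega>) (\<lambda>x. \<phi> x \<bullet> w x)"
proof -
  let ?K = "closure {x. \<phi> x \<noteq> 0}"
  note K = test_functions_supp[OF assms(2)]
  have Km: "?K \<in> sets lebesgue" by (simp add: sets_completionI_sets)
  note m = open_imp_sets_lebesgue[OF assms(1)]
  note c = smooth_continuous[OF test_functions_smooth[OF assms(2)]]
  have w: "integrable (lebesgue_on ?K) w" using assms(3) K by (simp add: locally_integrable_def)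
  obtain M where M: "M \<ge> 0" "\<And>x. norm (\<phi> x) \<le> M"
    using bounded_compact_supp[OF c K(1) closure_supp_zero[where f=\<phi>]] by metis
  have [measurable]: "\<phi> \<in> borel_measurable (lebesgue_on ?K)"
    using integrable_lborel_imp_lebesgue_on[OF integrable_compact_supp[OF c K(1) closure_supp_zero[where f=\<phi>]] Km] by auto
  have "integrable (lebesgue_on ?K) (\<lambda>x. \<phi> x \<bullet> w x)"
  proof (rule Bochner_Integration.integrable_bound)
    show "integrable (lebesgue_on ?K) (\<lambda>x. M * norm (w x))" using w by auto
    show "AE x in lebesgue_on ?K. norm (\<phi> x \<bullet> w x) \<le> norm (M * norm (w x))"
    proof (rule AE_I2)
      fix x
      have "\<bar>\<phi> x \<bullet> w x\<bar> \<le> norm (\<phi> x) * norm (w x)" by (rule Cauchy_Schwarz_ineq2)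
      also have "\<dots> \<le> M * norm (w x)" by (intro mult_right_mono M) simp
      finally show "norm (\<phi> x \<bullet> w x) \<le> norm (M * norm (w x))" using M(1) by simp
    qed
    show "(\<lambda>x. \<phi> x \<bullet> w x) \<in> borel_measurable (lebesgue_on ?K)" using w by measurable
  qed
  then have "integrable lebesgue (\<lambda>x. indicator ?K x *\<^sub>R (\<phi> x \<bullet> w x))"
    using Km by (simp add: integrable_restrict_space)
  also have "(\<lambda>x. indicator ?K x *\<^sub>R (\<phi> x \<bullet> w x)) = (\<lambda>x. indicator \<Omega> x *\<^sub>R (\<phi> x \<bullet> w x))"
  proof
    fix x show "indicator ?K x *\<^sub>R (\<phi> x \<bullet> w x) = indicator \<Omega> x *\<^sub>R (\<phi> x \<bullet> w x)"
      using K(2) closure_supp_zero[of x \<phi>] by (cases "x \<in> ?K") auto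
  qed
  finally show ?thesis using m by (simp add: integrable_restrict_space)
qed

text \<open>With \<open>d = bdist \<Omega>\<close>, the pairing is split into
  \<open>\<phi> / d\<close> and \<open>d w\<close>. After Cauchy--Schwarz, Hardy's inequality
  controls the first factor and \<open>W\<close> is the second. This makes the pairing a bounded
  functional for the Dirichlet energy.\<close>

lemma hardy_functional_bound:
  fixes \<phi> w :: "point \<Rightarrow> real ^ 3"
  assumes \<Omega>: "bounded_domain \<Omega>" and H: "hardy_inequality \<Omega> H"
    and \<phi>: "\<phi> \<in> test_functions \<Omega>" and w: "locally_integrable \<Omega> w"
    and W: "l2_normsq \<Omega> (\<lambda>x. bdist \<Omega> x *\<^sub>R w x) = ennreal W" "0 \<le> W"
  shows "(l2_inner \<Omega> \<phi> w)\<^sup>2 \<le> H * W * l2_inner \<Omega> (\<lambda>x. jacobian \<phi> (at x)) (\<lambda>x. jacobian \<phi> (at x))"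
proof -
  have op: "open \<Omega>" using \<Omega> by (simp add: bounded_domain_def)
  note m = open_imp_sets_lebesgue[OF op]
  let ?K = "closure {x. \<phi> x \<noteq> 0}"
  note K = test_functions_supp[OF \<phi>]
  have Km: "?K \<in> sets lebesgue" by (simp add: sets_completionI_sets)
  note c = smooth_continuous[OF test_functions_smooth[OF \<phi>]]
  have wi: "integrable (lebesgue_on ?K) w" using w K by (simp add: locally_integrable_def)
  have [measurable]: "w \<in> borel_measurable (lebesgue_on ?K)" using wi by auto
  have [measurable]: "\<phi> \<in> borel_measurable (lebesgue_on ?K)"
    using integrable_lborel_imp_lebesgue_on[OF integrable_compact_supp[OF c K(1) closure_supp_zero[where f=\<phi>]] Km] by auto
  have "bdist \<Omega> \<in> borel_measurable borel"
    unfolding bdist_def by (intro borel_measurable_continuous_onI continuous_intros)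
  then have [measurable]: "bdist \<Omega> \<in> borel_measurable (lebesgue_on ?K)"
    by (simp add: measurable_restrict_space1 measurable_completion)
  let ?A = "l2_inner \<Omega> (\<lambda>x. jacobian \<phi> (at x)) (\<lambda>x. jacobian \<phi> (at x))"
  note J = jacobian_L2[OF \<phi> m]
  have H0: "0 \<le> H" using H by (simp add: hardy_inequality_def)
  have "ennreal \<bar>l2_inner \<Omega> \<phi> w\<bar> \<le> (\<integral>\<^sup>+x. ennreal \<bar>\<phi> x \<bullet> w x\<bar> \<partial>lebesgue_on \<Omega>)"
    using integral_norm_bound_ennreal[OF integrable_test_function_locally_integrable[OF op \<phi> w]]
    by (simp add: l2_inner_def)
  \<comment> \<open>Local integrability provides measurability of \<open>w\<close> on compact
    subsets, so Cauchy--Schwarz is applied on the support of \<open>\<phi>\<close>; monotonicity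
    then enlarges both factors to \<open>\<Omega>\<close>.\<close>
  also have "\<dots> = (\<integral>\<^sup>+x. ennreal \<bar>\<phi> x \<bullet> w x\<bar> \<partial>lebesgue_on ?K)"
  proof -
    have "ennreal \<bar>\<phi> x \<bullet> w x\<bar> * indicator \<Omega> x = ennreal \<bar>\<phi> x \<bullet> w x\<bar> * indicator ?K x" for x
      using K(2) closure_supp_zero[of x \<phi>] by (cases "x \<in> ?K") auto
    then show ?thesis using m Km by (simp add: nn_integral_restrict_space)
  qed
  also have "\<dots> \<le> (\<integral>\<^sup>+x. ennreal (norm (\<phi> x) / bdist \<Omega> x) * ennreal (bdist \<Omega> x * norm (w x)) \<partial>lebesgue_on ?K)"
  proof (rule nn_integral_mono)
    fix x assume "x \<in> space (lebesgue_on ?K)"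
    then have "x \<in> \<Omega>" using K(2) by auto
    then have d: "bdist \<Omega> x > 0" by (rule bdist_pos[OF \<Omega>])
    have "\<bar>\<phi> x \<bullet> w x\<bar> \<le> norm (\<phi> x) * norm (w x)" by (rule Cauchy_Schwarz_ineq2)
    also have "\<dots> = (norm (\<phi> x) / bdist \<Omega> x) * (bdist \<Omega> x * norm (w x))" using d by simp
    finally show "ennreal \<bar>\<phi> x \<bullet> w x\<bar> \<le> ennreal (norm (\<phi> x) / bdist \<Omega> x) * ennreal (bdist \<Omega> x * norm (w x))"
      using d by (simp add: ennreal_mult[symmetric] ennreal_leI)
  qed
  finally have "(ennreal \<bar>l2_inner \<Omega> \<phi> w\<bar>)\<^sup>2 \<le> \<dots>\<^sup>2" by (rule power_mono) simp
  also have "\<dots> \<le> (\<integral>\<^sup>+x. (ennreal (norm (\<phi> x) / bdist \<Omega> x))\<^sup>2 \<partial>lebesgue_on ?K) *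
      (\<integral>\<^sup>+x. (ennreal (bdist \<Omega> x * norm (w x)))\<^sup>2 \<partial>lebesgue_on ?K)"
    by (rule Cauchy_Schwarz_nn_integral) measurable
  also have "\<dots> \<le> (\<integral>\<^sup>+x. (ennreal (norm (\<phi> x) / bdist \<Omega> x))\<^sup>2 \<partial>lebesgue_on \<Omega>) *
      (\<integral>\<^sup>+x. (ennreal (bdist \<Omega> x * norm (w x)))\<^sup>2 \<partial>lebesgue_on \<Omega>)"
    by (intro mult_mono nn_integral_lebesgue_on_mono K(2) Km m) auto
  also have "(\<integral>\<^sup>+x. (ennreal (norm (\<phi> x) / bdist \<Omega> x))\<^sup>2 \<partial>lebesgue_on \<Omega>) =
      (\<integral>\<^sup>+x. ennreal ((norm (\<phi> x))\<^sup>2 / (bdist \<Omega> x)\<^sup>2) \<partial>lebesgue_on \<Omega>)"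
    by (simp add: ennreal_power bdist_def infdist_nonneg power_divide)
  also have "(\<integral>\<^sup>+x. (ennreal (bdist \<Omega> x * norm (w x)))\<^sup>2 \<partial>lebesgue_on \<Omega>) = ennreal W"
    unfolding W(1)[symmetric] l2_normsq_def
    by (simp add: ennreal_power bdist_def infdist_nonneg)
  also have "(\<integral>\<^sup>+x. ennreal ((norm (\<phi> x))\<^sup>2 / (bdist \<Omega> x)\<^sup>2) \<partial>lebesgue_on \<Omega>) * ennreal W
      \<le> (ennreal H * ennreal ?A) * ennreal W"
  proof (rule mult_right_mono)
    show "(\<integral>\<^sup>+x. ennreal ((norm (\<phi> x))\<^sup>2 / (bdist \<Omega> x)\<^sup>2) \<partial>lebesgue_on \<Omega>) \<le> ennreal H * ennreal ?A"
      using H test_functions_H10[OF op \<phi>] has_L2_gradient_test_function[OF op \<phi>]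
      unfolding hardy_inequality_def l2_normsq_eq_inner[OF J, symmetric] by blast
  qed simp
  also have "\<dots> = ennreal (H * W * ?A)"
    using H0 W(2) by (simp add: ennreal_mult[symmetric] l2_inner_nonneg mult_ac)
  also have "(ennreal \<bar>l2_inner \<Omega> \<phi> w\<bar>)\<^sup>2 = ennreal ((l2_inner \<Omega> \<phi> w)\<^sup>2)"
    by (simp add: ennreal_power)
  finally show ?thesis
    using H0 W(2) by (subst (asm) ennreal_le_iff) (auto intro!: mult_nonneg_nonneg l2_inner_nonneg)
qed

text \<open>Energy minimization with \<open>C = H * W\<close>; \<open>G\<close> takes the role of
  the gradient of the solution. The sequence \<open>\<phi>\<close> is returned as well, because
  further properties of \<open>G\<close> are proved for the Jacobians of \<open>\<phi> n\<close> and
  passed to the limit.\<close>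

lemma weak_vector_laplace_solution:
  fixes w :: "point \<Rightarrow> real ^ 3"
  assumes \<Omega>: "bounded_domain \<Omega>" and H: "hardy_inequality \<Omega> H"
    and w: "locally_integrable \<Omega> w"
    and W: "l2_normsq \<Omega> (\<lambda>x. bdist \<Omega> x *\<^sub>R w x) = ennreal W" "0 \<le> W"
  obtains G \<phi> where "G \<in> L2 \<Omega>" "\<And>n. \<phi> n \<in> test_functions \<Omega>"
    and "(\<lambda>n. l2_inner \<Omega> (\<lambda>x. jacobian (\<phi> n) (at x) - G x) (\<lambda>x. jacobian (\<phi> n) (at x) - G x)) \<longlonglongrightarrow> 0"
    and "\<And>\<psi>. \<psi> \<in> test_functions \<Omega> \<Longrightarrow> l2_inner \<Omega> G (\<lambda>x. jacobian \<psi> (at x)) = l2_inner \<Omega> \<psi> w"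
    and "l2_inner \<Omega> G G \<le> H * W"
proof -
  have op: "open \<Omega>" using \<Omega> by (simp add: bounded_domain_def)
  note m = open_imp_sets_lebesgue[OF op]
  have HW: "0 \<le> H * W" using H W(2) by (simp add: hardy_inequality_def)
  let ?J = "\<lambda>\<phi> x. jacobian \<phi> (at x)"
  note J = jacobian_L2[OF _ m]
  obtain \<phi> where \<phi>: "\<And>n. \<phi> n \<in> test_functions \<Omega>"
    and cauchy: "\<And>n m. n \<le> m \<Longrightarrow>
      l2_inner \<Omega> (?J (\<lambda>x. \<phi> m x - \<phi> n x)) (?J (\<lambda>x. \<phi> m x - \<phi> n x)) \<le> 4 * (1/4)^n"
    and lim: "\<And>\<psi>. \<psi> \<in> test_functions \<Omega> \<Longrightarrow>
      (\<lambda>n. l2_inner \<Omega> (?J (\<phi> n)) (?J \<psi>)) \<longlonglongrightarrow> l2_inner \<Omega> \<psi> w"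
  proof (rule minimizing_sequence[where V="test_functions \<Omega>" and a="\<lambda>\<phi>. l2_inner \<Omega> (?J \<phi>) (?J \<phi>)"
        and b="\<lambda>\<phi> \<psi>. l2_inner \<Omega> (?J \<phi>) (?J \<psi>)" and l="\<lambda>\<phi>. l2_inner \<Omega> \<phi> w" and C="H * W"])
    show "test_functions \<Omega> \<noteq> {}" using test_functions_zero by blast
    fix s t and f g :: "point \<Rightarrow> real ^ 3"
    assume fg: "f \<in> test_functions \<Omega>" "g \<in> test_functions \<Omega>"
    show "(\<lambda>x. s *\<^sub>R f x + t *\<^sub>R g x) \<in> test_functions \<Omega>" using fg by (rule test_functions_lincomb)
    show "l2_inner \<Omega> (?J (\<lambda>x. s *\<^sub>R f x + t *\<^sub>R g x)) (?J (\<lambda>x. s *\<^sub>R f x + t *\<^sub>R g x)) =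
       s\<^sup>2 * l2_inner \<Omega> (?J f) (?J f) + 2 * s * t * l2_inner \<Omega> (?J f) (?J g) + t\<^sup>2 * l2_inner \<Omega> (?J g) (?J g)"
      unfolding jacobian_lincomb[OF fg] by (rule l2_inner_quadratic[OF J[OF fg(1)] J[OF fg(2)]])
    show "l2_inner \<Omega> (\<lambda>x. s *\<^sub>R f x + t *\<^sub>R g x) w = s * l2_inner \<Omega> f w + t * l2_inner \<Omega> g w"
      using integrable_test_function_locally_integrable[OF op fg(1) w]
        integrable_test_function_locally_integrable[OF op fg(2) w]
      by (simp add: l2_inner_def inner_add_left)
    show "(l2_inner \<Omega> f w)\<^sup>2 \<le> H * W * l2_inner \<Omega> (?J f) (?J f)"
      by (rule hardy_functional_bound[OF \<Omega> H fg(1) w W])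
  qed (auto simp: l2_inner_nonneg HW)
  have diff: "?J (\<lambda>x. \<phi> m x - \<phi> n x) = (\<lambda>x. ?J (\<phi> m) x - ?J (\<phi> n) x)" for m n
    using jacobian_lincomb[OF \<phi> \<phi>, of 1 m "-1" n] by (simp add: fun_eq_iff)
  obtain G where G: "G \<in> L2 \<Omega>"
    and conv: "(\<lambda>n. l2_inner \<Omega> (\<lambda>x. ?J (\<phi> n) x - G x) (\<lambda>x. ?J (\<phi> n) x - G x)) \<longlonglongrightarrow> 0"
    using L2_complete[of "\<lambda>n. ?J (\<phi> n)" \<Omega> 4] J[OF \<phi>] cauchy unfolding diff by blast
  have weak: "l2_inner \<Omega> G (?J \<psi>) = l2_inner \<Omega> \<psi> w" if "\<psi> \<in> test_functions \<Omega>" for \<psi>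
    using l2_inner_tendsto_left[OF J[OF \<phi>] G J[OF that] conv] lim[OF that] by (rule LIMSEQ_unique)
  have GG: "(\<lambda>n. l2_inner \<Omega> (?J (\<phi> n)) (?J (\<phi> n))) \<longlonglongrightarrow> l2_inner \<Omega> G G"
    by (rule l2_inner_tendsto[OF J[OF \<phi>] J[OF \<phi>] G G conv conv])
  have GJ: "(\<lambda>n. l2_inner \<Omega> G (?J (\<phi> n))) \<longlonglongrightarrow> l2_inner \<Omega> G G"
    using l2_inner_tendsto_left[OF J[OF \<phi>] G G conv] by (simp add: l2_inner_commute)
  \<comment> \<open>The weak equation turns the pairing of \<open>\<phi> n\<close> with
    \<open>w\<close> into \<open>l2_inner \<Omega> G (?J (\<phi> n))\<close>. The Hardy bound
    survives the limit, and cancelling one factor \<open>l2_inner \<Omega> G G\<close> gives the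
    energy estimate.\<close>
  have "(l2_inner \<Omega> G G)\<^sup>2 \<le> H * W * l2_inner \<Omega> G G"
  proof (rule LIMSEQ_le)
    show "(\<lambda>n. (l2_inner \<Omega> G (?J (\<phi> n)))\<^sup>2) \<longlonglongrightarrow> (l2_inner \<Omega> G G)\<^sup>2" by (rule tendsto_power[OF GJ])
    show "(\<lambda>n. H * W * l2_inner \<Omega> (?J (\<phi> n)) (?J (\<phi> n))) \<longlonglongrightarrow> H * W * l2_inner \<Omega> G G"
      by (rule tendsto_mult_left[OF GG])
    show "\<exists>N. \<forall>n\<ge>N. (l2_inner \<Omega> G (?J (\<phi> n)))\<^sup>2 \<le> H * W * l2_inner \<Omega> (?J (\<phi> n)) (?J (\<phi> n))"
      using hardy_functional_bound[OF \<Omega> H \<phi> w W] by (simp add: weak[OF \<phi>])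
  qed
  then have "l2_inner \<Omega> G G \<le> H * W"
    using HW l2_inner_nonneg[of \<Omega> G] by (cases "l2_inner \<Omega> G G = 0") (auto simp: power2_eq_square)
  from that[OF G \<phi> conv weak this] show thesis by blast
qed

section \<open>The orthogonal complement of the kernel of \<open>rot\<close>\<close>

lemma ker_rot_perp_diff:
  assumes "v \<in> ker_rot_perp \<Omega>" "z \<in> ker_rot_perp \<Omega>"
  shows "(\<lambda>x. v x - z x) \<in> ker_rot_perp \<Omega>"
  using assms by (auto simp: ker_rot_perp_def L2_diff l2_inner_diff_left ker_rot_def)

text \<open>Gradients of test functions lie in the kernel of \<open>rot\<close>, and orthogonality
  to them is the weak form of zero divergence.\<close>

lemma ker_rot_perp_div:
  assumes op: "open \<Omega>" and v: "v \<in> ker_rot_perp \<Omega>"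
  shows "distr_eq \<Omega> (distr_div (distr \<Omega> v)) (\<lambda>_. 0)"
  unfolding distr_eq_def
proof
  fix \<eta> :: "point \<Rightarrow> real" assume \<eta>: "\<eta> \<in> test_functions \<Omega>"
  have v2: "v \<in> L2 \<Omega>" using v by (simp add: ker_rot_perp_def)
  note k = gradient_in_ker_rot[OF op \<eta>]
  have "distr_div (distr \<Omega> v) \<eta> = - l2_inner \<Omega> v (\<lambda>x. \<chi> i. pderiv_at i \<eta> x)"
    using k v2 by (simp add: distr_div_def distr_pderiv_nth[OF op \<eta> v2] l2_inner_vec ker_rot_def
        sum_negf l2_inner_commute[of \<Omega> "\<lambda>x. v x $ _"])
  then show "distr_div (distr \<Omega> v) \<eta> = 0"
    using v k by (simp add: ker_rot_perp_def)
qed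

text \<open>Curls of test fields are orthogonal to the kernel, and orthogonality to a fixed
  \<open>z\<close> is preserved under \<open>L2\<close> limits.\<close>

lemma ker_rot_perp_curl_limit:
  assumes op: "open \<Omega>" and G: "G \<in> L2 \<Omega>" and \<phi>: "\<And>n. \<phi> n \<in> test_functions \<Omega>"
    and conv: "(\<lambda>n. l2_inner \<Omega> (\<lambda>x. jacobian (\<phi> n) (at x) - G x) (\<lambda>x. jacobian (\<phi> n) (at x) - G x)) \<longlonglongrightarrow> 0"
  shows "(\<lambda>x. curl_of_jacobian (G x)) \<in> ker_rot_perp \<Omega>"
proof -
  note T = bounded_linear_curl_of_jacobian
  note J = jacobian_L2[OF \<phi> open_imp_sets_lebesgue[OF op]]
  have "l2_inner \<Omega> (\<lambda>x. curl_of_jacobian (G x)) z = 0" if z: "z \<in> ker_rot \<Omega>" for z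
  proof -
    have "(\<lambda>n. l2_inner \<Omega> (\<lambda>x. curl_of_jacobian (jacobian (\<phi> n) (at x))) z)
        \<longlonglongrightarrow> l2_inner \<Omega> (\<lambda>x. curl_of_jacobian (G x)) z"
      using z L2_bounded_linear[OF T J] L2_bounded_linear[OF T G] l2_tendsto_bounded_linear[OF T J G conv]
      by (intro l2_inner_tendsto_left) (auto simp: ker_rot_def)
    then show ?thesis
      by (simp add: curl_test_function_orthogonal_ker_rot[OF op \<phi> z] LIMSEQ_const_iff)
  qed
  then show ?thesis using L2_bounded_linear[OF T G] by (simp add: ker_rot_perp_def)
qed

section \<open>The weighted inequality\<close>

text \<open>Both identities hold for the Jacobians of \<open>\<phi> n\<close> by
  \<open>l2_inner_pderiv_swap\<close> and pass to the limit. The first says that the rows of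
  \<open>G\<close> are weakly curl free; the second makes the principal 2 by 2 minors of
  \<open>G\<close> integrate to zero.\<close>

lemma jacobian_limit_swap:
  assumes op: "open \<Omega>" and G: "G \<in> L2 \<Omega>" and \<phi>: "\<And>n. \<phi> n \<in> test_functions \<Omega>"
    and conv: "(\<lambda>n. l2_inner \<Omega> (\<lambda>x. jacobian (\<phi> n) (at x) - G x) (\<lambda>x. jacobian (\<phi> n) (at x) - G x)) \<longlonglongrightarrow> 0"
  shows "\<eta> \<in> test_functions \<Omega> \<Longrightarrow> l2_inner \<Omega> (pderiv_at i \<eta>) (\<lambda>x. G x $ k $ j) = l2_inner \<Omega> (pderiv_at j \<eta>) (\<lambda>x. G x $ k $ i)"
    and "l2_inner \<Omega> (\<lambda>x. G x $ i $ i) (\<lambda>x. G x $ j $ j) = l2_inner \<Omega> (\<lambda>x. G x $ i $ j) (\<lambda>x. G x $ j $ i)"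
proof -
  note m = open_imp_sets_lebesgue[OF op]
  note J = jacobian_L2[OF \<phi> m]
  have T: "bounded_linear (\<lambda>A. (A :: real ^ 3 ^ 3) $ k $ j)" for k j
    by (intro bounded_linear_compose[OF bounded_linear_vec_nth] bounded_linear_vec_nth)
  have comp: "(\<lambda>x. \<phi> n x $ k) \<in> test_functions \<Omega>" for k n
    by (rule test_functions_bounded_linear[OF bounded_linear_vec_nth \<phi>])
  let ?d = "\<lambda>n k j. pderiv_at j (\<lambda>x. \<phi> n x $ k)"
  have e: "jacobian (\<phi> n) (at x) $ k $ j = ?d n k j x" for n k j x
    using pderiv_at_nth[OF \<phi>] by (simp add: jacobian_nth)
  have d: "?d n k j \<in> L2 \<Omega>" for n k j
    using comp m by (simp add: test_functions_L2 test_functions_pderiv)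
  have Gc: "(\<lambda>x. G x $ k $ j) \<in> L2 \<Omega>" for k j by (rule L2_bounded_linear[OF T G])
  have lim: "(\<lambda>n. l2_inner \<Omega> (\<lambda>x. ?d n k j x - G x $ k $ j) (\<lambda>x. ?d n k j x - G x $ k $ j)) \<longlonglongrightarrow> 0" for k j
    using l2_tendsto_bounded_linear[OF T J G conv] by (simp only: e)
  {
    assume \<eta>: "\<eta> \<in> test_functions \<Omega>"
    have dn: "pderiv_at i \<eta> \<in> L2 \<Omega>" for i using \<eta> m by (simp add: test_functions_L2 test_functions_pderiv)
    have eq: "l2_inner \<Omega> (?d n k j) (pderiv_at i \<eta>) = l2_inner \<Omega> (?d n k i) (pderiv_at j \<eta>)" for n
      by (rule l2_inner_pderiv_swap[OF comp \<eta> m])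
    have "(\<lambda>n. l2_inner \<Omega> (?d n k j) (pderiv_at i \<eta>)) \<longlonglongrightarrow> l2_inner \<Omega> (\<lambda>x. G x $ k $ i) (pderiv_at j \<eta>)"
      unfolding eq by (rule l2_inner_tendsto_left[OF d Gc dn lim])
    from LIMSEQ_unique[OF l2_inner_tendsto_left[OF d Gc dn lim] this]
    show "l2_inner \<Omega> (pderiv_at i \<eta>) (\<lambda>x. G x $ k $ j) = l2_inner \<Omega> (pderiv_at j \<eta>) (\<lambda>x. G x $ k $ i)"
      by (simp add: l2_inner_commute)
  }
  have eq: "l2_inner \<Omega> (?d n i i) (?d n j j) = l2_inner \<Omega> (?d n i j) (?d n j i)" for n
    by (rule l2_inner_pderiv_swap[OF comp comp m])
  have "(\<lambda>n. l2_inner \<Omega> (?d n i i) (?d n j j)) \<longlonglongrightarrow> l2_inner \<Omega> (\<lambda>x. G x $ i $ j) (\<lambda>x. G x $ j $ i)"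
    unfolding eq by (rule l2_inner_tendsto[OF d d Gc Gc lim lim])
  from LIMSEQ_unique[OF l2_inner_tendsto[OF d d Gc Gc lim lim] this]
  show "l2_inner \<Omega> (\<lambda>x. G x $ i $ i) (\<lambda>x. G x $ j $ j) = l2_inner \<Omega> (\<lambda>x. G x $ i $ j) (\<lambda>x. G x $ j $ i)" .
qed

text \<open>The weak equation is tested with \<open>\<eta>\<close> times the unit vector
  \<open>axis k 1\<close>, whose Jacobian has only row \<open>k\<close>. Weakly, minus the
  divergence of row \<open>k\<close> of \<open>G\<close> is component \<open>k\<close> of
  \<open>w\<close>.\<close>

lemma weak_laplace_component:
  fixes w :: "point \<Rightarrow> real ^ 3"
  assumes op: "open \<Omega>" and G: "G \<in> L2 \<Omega>" and w: "locally_integrable \<Omega> w"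
    and weak: "\<And>\<psi>. \<psi> \<in> test_functions \<Omega> \<Longrightarrow> l2_inner \<Omega> G (\<lambda>x. jacobian \<psi> (at x)) = l2_inner \<Omega> \<psi> w"
    and \<eta>: "\<eta> \<in> test_functions \<Omega>"
  shows "distr \<Omega> w \<eta> $ k = (\<Sum>i\<in>UNIV. l2_inner \<Omega> (pderiv_at i \<eta>) (\<lambda>x. G x $ k $ i))"
proof -
  note m = open_imp_sets_lebesgue[OF op]
  let ?\<psi> = "\<lambda>a x. \<eta> x *\<^sub>R axis a (1::real) :: real ^ 3"
  have \<psi>: "?\<psi> a \<in> test_functions \<Omega>" for a
    by (rule test_functions_bounded_linear[OF bounded_linear_scaleR_left \<eta>])
  have jac: "jacobian (?\<psi> k) (at x) $ j = (if j = k then (\<chi> i. pderiv_at i \<eta> x) else 0)" for x j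
    using pderiv_at_bounded_linear[OF bounded_linear_scaleR_left test_functions_smooth[OF \<eta>], of _ "axis k (1::real)" x]
    by (auto simp: vec_eq_iff jacobian_nth axis_def)
  have int: "integrable (lebesgue_on \<Omega>) (\<lambda>x. ?\<psi> a x \<bullet> w x)" for a
    by (rule integrable_test_function_locally_integrable[OF op \<psi> w])
  \<comment> \<open>The vector integrand is assembled from its scalar components, because a
    projection may be moved into the integral only after the whole vector is known to be
    integrable.\<close>
  have "integrable (lebesgue_on \<Omega>) (\<lambda>x. \<Sum>a\<in>UNIV. (?\<psi> a x \<bullet> w x) *\<^sub>R axis a (1::real) :: real ^ 3)"
    using int by (intro Bochner_Integration.integrable_sum integrable_scaleR_left) auto
  also have "(\<lambda>x. \<Sum>a\<in>UNIV. (?\<psi> a x \<bullet> w x) *\<^sub>R axis a (1::real)) = (\<lambda>x. \<eta> x *\<^sub>R w x)"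
  proof
    fix x
    have "?\<psi> a x \<bullet> w x = \<eta> x * w x $ a" for a by (simp add: inner_axis')
    then show "(\<Sum>a\<in>UNIV. (?\<psi> a x \<bullet> w x) *\<^sub>R axis a (1::real)) = \<eta> x *\<^sub>R w x"
      by (simp add: vec_eq_iff axis_def if_distrib[of "\<lambda>t. _ * t"] cong: if_cong)
  qed
  finally have "integrable (lebesgue_on \<Omega>) (\<lambda>x. \<eta> x *\<^sub>R w x)" .
  from integral_bounded_linear[OF bounded_linear_vec_nth this, of k]
  have "distr \<Omega> w \<eta> $ k = (\<integral>x. (\<eta> x *\<^sub>R w x) $ k \<partial>lebesgue_on \<Omega>)"
    by (simp add: distr_def)
  also have "\<dots> = l2_inner \<Omega> (?\<psi> k) w"
    by (simp add: l2_inner_def inner_axis')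
  also have "\<dots> = l2_inner \<Omega> G (\<lambda>x. jacobian (?\<psi> k) (at x))" by (rule weak[OF \<psi>, symmetric])
  also have "\<dots> = l2_inner \<Omega> (\<lambda>x. G x $ k) (\<lambda>x. \<chi> i. pderiv_at i \<eta> x)"
  proof -
    have "G x \<bullet> jacobian (?\<psi> k) (at x) = G x $ k \<bullet> (\<chi> i. pderiv_at i \<eta> x)" for x
      by (simp add: inner_vec_def[of "G x"] jac if_distrib[of "\<lambda>t. _ \<bullet> t"] cong: if_cong)
    then show ?thesis by (simp add: l2_inner_def)
  qed
  also have "\<dots> = (\<Sum>i\<in>UNIV. l2_inner \<Omega> (\<lambda>x. G x $ k $ i) (pderiv_at i \<eta>))"
    using L2_nth[OF G] \<eta> m
    by (subst l2_inner_vec) (auto intro!: L2_vec simp: test_functions_L2 test_functions_pderiv)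
  finally show ?thesis by (simp add: l2_inner_commute)
qed

lemma weighted_rot_bound:
  fixes v w :: "point \<Rightarrow> real ^ 3"
  assumes \<Omega>: "bounded_domain \<Omega>" and H: "hardy_inequality \<Omega> H" and \<Gamma>: "friedrichs_velte2 \<Omega> \<Gamma>"
    and v: "v \<in> ker_rot_perp \<Omega>" and w: "locally_integrable \<Omega> w"
    and rot: "distr_eq \<Omega> (distr_rot (distr \<Omega> v)) (distr \<Omega> w)"
    and W: "l2_normsq \<Omega> (\<lambda>x. bdist \<Omega> x *\<^sub>R w x) = ennreal W" "0 \<le> W"
  shows "l2_inner \<Omega> v v \<le> H * (1 + \<Gamma>) * W"
proof -
  have op: "open \<Omega>" using \<Omega> by (simp add: bounded_domain_def)
  note m = open_imp_sets_lebesgue[OF op]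
  obtain G \<phi> where G: "G \<in> L2 \<Omega>" and \<phi>: "\<And>n. \<phi> n \<in> test_functions \<Omega>"
    and conv: "(\<lambda>n. l2_inner \<Omega> (\<lambda>x. jacobian (\<phi> n) (at x) - G x) (\<lambda>x. jacobian (\<phi> n) (at x) - G x)) \<longlonglongrightarrow> 0"
    and weak: "\<And>\<psi>. \<psi> \<in> test_functions \<Omega> \<Longrightarrow> l2_inner \<Omega> G (\<lambda>x. jacobian \<psi> (at x)) = l2_inner \<Omega> \<psi> w"
    and GW: "l2_inner \<Omega> G G \<le> H * W"
    by (rule weak_vector_laplace_solution[OF \<Omega> H w W]) blast
  note swap = jacobian_limit_swap[OF op G \<phi> conv]
  \<comment> \<open>\<open>R\<close> and \<open>u\<close> stand for \<open>rot \<psi>\<close> and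
    \<open>- div \<psi>\<close>, expressed through the gradient \<open>G\<close> alone.\<close>
  define R where "R x = curl_of_jacobian (G x)" for x
  define u where "u x = - trace (G x)" for x
  have v2: "v \<in> L2 \<Omega>" using v by (simp add: ker_rot_perp_def)
  have R: "R \<in> ker_rot_perp \<Omega>"
    using ker_rot_perp_curl_limit[OF op G \<phi> conv] unfolding R_def .
  then have R2: "R \<in> L2 \<Omega>" by (simp add: ker_rot_perp_def)
  have u2: "u \<in> L2 \<Omega>"
    unfolding u_def by (rule L2_bounded_linear[OF bounded_linear_minus[OF bounded_linear_trace] G])
  have vR: "(\<lambda>x. v x - R x) \<in> ker_rot_perp \<Omega>" by (rule ker_rot_perp_diff[OF v R])
  have vR2: "(\<lambda>x. v x - R x) \<in> L2 \<Omega>" by (rule L2_diff[OF v2 R2])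
  have Gc: "(\<lambda>x. G x $ k $ j) \<in> L2 \<Omega>" for k j using G by (intro L2_nth)
  \<comment> \<open>Weak form of
    \<open>- \<Delta>\<psi> - rot rot \<psi> = - \<nabla> div \<psi>\<close>, where
    \<open>rot v = w = - \<Delta>\<psi>\<close>.\<close>
  have "distr_eq \<Omega> (distr_rot (distr \<Omega> (\<lambda>x. v x - R x))) (distr_grad (distr \<Omega> u))"
    unfolding distr_eq_def
  proof
    fix \<eta> :: "point \<Rightarrow> real" assume \<eta>: "\<eta> \<in> test_functions \<Omega>"
    let ?c = "\<lambda>i k j. l2_inner \<Omega> (pderiv_at i \<eta>) (\<lambda>x. G x $ k $ j)"
    have d: "pderiv_at i \<eta> \<in> L2 \<Omega>" for i using \<eta> m by (simp add: test_functions_L2 test_functions_pderiv)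
    have "distr_rot (distr \<Omega> v) \<eta> $ k = (\<Sum>i\<in>UNIV. ?c i k i)" for k
      using rot \<eta> weak_laplace_component[OF op G w weak \<eta>] by (simp add: distr_eq_def)
    then have rot_v: "distr_rot (distr \<Omega> (\<lambda>x. v x - R x)) \<eta> $ k = ?c 1 k 1 + ?c 2 k 2 + ?c 3 k 3 - distr_rot (distr \<Omega> R) \<eta> $ k" for k
      using distr_rot_nth[OF op \<eta> vR2] distr_rot_nth[OF op \<eta> v2] distr_rot_nth[OF op \<eta> R2] exhaust_3[of k]
      by (auto simp: l2_inner_diff_right[OF L2_nth[OF v2] L2_nth[OF R2] d] sum_3)
    have rot_R: "distr_rot (distr \<Omega> R) \<eta> $ 1 = (?c 3 1 3 - ?c 3 3 1) - (?c 2 2 1 - ?c 2 1 2)"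
      "distr_rot (distr \<Omega> R) \<eta> $ 2 = (?c 1 2 1 - ?c 1 1 2) - (?c 3 3 2 - ?c 3 2 3)"
      "distr_rot (distr \<Omega> R) \<eta> $ 3 = (?c 2 3 2 - ?c 2 2 3) - (?c 1 1 3 - ?c 1 3 1)"
      using distr_rot_nth[OF op \<eta> R2] by (simp_all add: R_def l2_inner_diff_right[OF Gc Gc d])
    have "distr_grad (distr \<Omega> u) \<eta> $ k = l2_inner \<Omega> (pderiv_at k \<eta>) (\<lambda>x. trace (G x))" for k
      by (simp add: distr_grad_def distr_pderiv_def distr_real u_def l2_inner_def)
    also have "\<dots> k = ?c k 1 1 + ?c k 2 2 + ?c k 3 3" for k
      using Gc d by (simp add: trace_def sum_3 l2_inner_add_right L2_add)
    \<comment> \<open>After cancellation component \<open>k\<close> has the terms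
      \<open>?c i i k\<close> on the left and \<open>?c k i i\<close> on the right;
      \<open>swap(1)\<close> equates them.\<close>
    finally show "distr_rot (distr \<Omega> (\<lambda>x. v x - R x)) \<eta> = distr_grad (distr \<Omega> u) \<eta>"
      using swap(1)[OF \<eta>, of 2 2 1] swap(1)[OF \<eta>, of 3 3 1] swap(1)[OF \<eta>, of 1 1 2]
        swap(1)[OF \<eta>, of 3 3 2] swap(1)[OF \<eta>, of 1 1 3] swap(1)[OF \<eta>, of 2 2 3]
      by (simp add: vec_eq_iff forall_3 rot_v rot_R)
  qed
  then have "l2_normsq \<Omega> (\<lambda>x. v x - R x) \<le> ennreal \<Gamma> * l2_normsq \<Omega> u"
    using \<Gamma> u2 vR ker_rot_perp_div[OF op vR] unfolding friedrichs_velte2_def by blast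
  moreover have \<Gamma>0: "0 \<le> \<Gamma>" using \<Gamma> by (simp add: friedrichs_velte2_def)
  ultimately have fv: "l2_inner \<Omega> (\<lambda>x. v x - R x) (\<lambda>x. v x - R x) \<le> \<Gamma> * l2_inner \<Omega> u u"
    by (simp add: l2_normsq_eq_inner[OF vR2] l2_normsq_eq_inner[OF u2] ennreal_mult[symmetric] l2_inner_nonneg
        ennreal_le_iff)
  \<comment> \<open>The pointwise decomposition is integrated, and \<open>swap(2)\<close> removes
    the three minors.\<close>
  have GG: "l2_inner \<Omega> G G = l2_inner \<Omega> u u + l2_inner \<Omega> R R"
  proof -
    let ?g = "\<lambda>i j k l. \<integral>x. G x $ i $ j * G x $ k $ l \<partial>lebesgue_on \<Omega>"
    have g: "integrable (lebesgue_on \<Omega>) (\<lambda>x. G x $ i $ j * G x $ k $ l)" for i j k l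
      using L2_inner_integrable[OF Gc[of i j] Gc[of k l]] by simp
    have "l2_inner \<Omega> G G = l2_inner \<Omega> u u + l2_inner \<Omega> R R
      + 2 * (?g 1 2 2 1 - ?g 1 1 2 2) + 2 * (?g 1 3 3 1 - ?g 1 1 3 3) + 2 * (?g 2 3 3 2 - ?g 2 2 3 3)"
      using g L2_inner_integrable[OF u2 u2] L2_inner_integrable[OF R2 R2]
      unfolding l2_inner_def trace_curl_decomposition u_def R_def by simp
    then show ?thesis
      using swap(2)[of 1 2] swap(2)[of 1 3] swap(2)[of 2 3] by (simp add: l2_inner_def)
  qed
  let ?N = "\<lambda>f. sqrt (l2_inner \<Omega> f f)"
  have "sqrt (l2_inner \<Omega> v v) \<le> sqrt (l2_inner \<Omega> (\<lambda>x. v x - R x) (\<lambda>x. v x - R x)) + sqrt (l2_inner \<Omega> R R)"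
    using l2_triangle[OF vR2 R2] by simp
  also have "\<dots> \<le> sqrt \<Gamma> * sqrt (l2_inner \<Omega> u u) + sqrt (l2_inner \<Omega> R R)"
    using real_sqrt_le_mono[OF fv] by (simp add: real_sqrt_mult)
  finally have "(sqrt (l2_inner \<Omega> v v))\<^sup>2 \<le> (sqrt \<Gamma> * sqrt (l2_inner \<Omega> u u) + sqrt (l2_inner \<Omega> R R))\<^sup>2"
    by (rule power_mono) (simp add: l2_inner_nonneg)
  then have "l2_inner \<Omega> v v \<le> (sqrt \<Gamma> * sqrt (l2_inner \<Omega> u u) + 1 * sqrt (l2_inner \<Omega> R R))\<^sup>2"
    by (simp add: l2_inner_nonneg)
  \<comment> \<open>Cauchy--Schwarz in the plane for \<open>(sqrt \<Gamma>, 1)\<close> and the norms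
    of \<open>u\<close> and \<open>R\<close>, the source of the factor \<open>1 + \<Gamma>\<close>.
    The gap between the two sides is the square of \<open>p * r - q\<close>.\<close>
  also have "\<dots> \<le> ((sqrt \<Gamma>)\<^sup>2 + 1\<^sup>2) * ((sqrt (l2_inner \<Omega> u u))\<^sup>2 + (sqrt (l2_inner \<Omega> R R))\<^sup>2)"
  proof -
    have "(p * q + 1 * r)\<^sup>2 \<le> (p\<^sup>2 + 1\<^sup>2) * (q\<^sup>2 + r\<^sup>2)" for p q r :: real
      using zero_le_power2[of "p * r - q"] by (simp add: power2_eq_square algebra_simps)
    then show ?thesis .
  qed
  also have "\<dots> = (1 + \<Gamma>) * l2_inner \<Omega> G G"
    using \<Gamma>0 by (simp add: GG l2_inner_nonneg)
  also have "\<dots> \<le> (1 + \<Gamma>) * (H * W)"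
    using \<Gamma>0 GW by (intro mult_left_mono) auto
  finally show ?thesis by (simp add: mult_ac)
qed

text \<open>The weighted norm is an infimum over representatives \<open>w\<close> of
  \<open>rot v\<close>, so the bound is applied to a near-minimizer and the error is sent to
  zero.\<close>

lemma weighted_rot_inequality_product:
  assumes \<Omega>: "bounded_domain \<Omega>" and H: "hardy_inequality \<Omega> H" and \<Gamma>: "friedrichs_velte2 \<Omega> \<Gamma>"
  shows "weighted_rot_inequality \<Omega> (H * (1 + \<Gamma>))"
  unfolding weighted_rot_inequality_def
proof (intro conjI ballI impI)
  show P: "0 \<le> H * (1 + \<Gamma>)"
    using H \<Gamma> by (simp add: hardy_inequality_def friedrichs_velte2_def)
  fix v assume v: "v \<in> ker_rot_perp \<Omega>" and fin: "weighted_rot_normsq \<Omega> v < \<infinity>"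
  have v2: "v \<in> L2 \<Omega>" using v by (simp add: ker_rot_perp_def)
  obtain r where r: "weighted_rot_normsq \<Omega> v = ennreal r" "0 \<le> r"
    using fin by (cases "weighted_rot_normsq \<Omega> v") auto
  have "l2_inner \<Omega> v v \<le> H * (1 + \<Gamma>) * r"
  proof (rule field_le_epsilon)
    fix e :: real assume e: "0 < e"
    \<comment> \<open>The summand 1 keeps the denominator positive even when
      \<open>H = 0\<close>.\<close>
    define \<delta> where "\<delta> = e / (H * (1 + \<Gamma>) + 1)"
    have \<delta>: "0 < \<delta>" "H * (1 + \<Gamma>) * \<delta> \<le> e" using P e by (auto simp: \<delta>_def field_simps)
    have "weighted_rot_normsq \<Omega> v < ennreal (r + \<delta>)" using r \<delta> by (simp add: ennreal_lessI)
    then obtain w where w: "locally_integrable \<Omega> w" "distr_eq \<Omega> (distr_rot (distr \<Omega> v)) (distr \<Omega> w)"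
      and lt: "l2_normsq \<Omega> (\<lambda>x. bdist \<Omega> x *\<^sub>R w x) < ennreal (r + \<delta>)"
      unfolding weighted_rot_normsq_def INF_less_iff by blast
    obtain W where W: "l2_normsq \<Omega> (\<lambda>x. bdist \<Omega> x *\<^sub>R w x) = ennreal W" "0 \<le> W"
      using lt by (cases "l2_normsq \<Omega> (\<lambda>x. bdist \<Omega> x *\<^sub>R w x)") auto
    have "W \<le> r + \<delta>" using lt W r(2) \<delta>(1) by (simp add: ennreal_less_iff del: ennreal_plus)
    have "l2_inner \<Omega> v v \<le> H * (1 + \<Gamma>) * W"
      by (rule weighted_rot_bound[OF \<Omega> H \<Gamma> v w W])
    also have "\<dots> \<le> H * (1 + \<Gamma>) * (r + \<delta>)" by (rule mult_left_mono[OF \<open>W \<le> r + \<delta>\<close> P])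
    finally show "l2_inner \<Omega> v v \<le> H * (1 + \<Gamma>) * r + e" using \<delta>(2) by (simp add: distrib_left)
  qed
  then show "l2_normsq \<Omega> v \<le> ennreal (H * (1 + \<Gamma>)) * weighted_rot_normsq \<Omega> v"
    using P r by (simp add: l2_normsq_eq_inner[OF v2] ennreal_mult[symmetric] ennreal_leI)
qed

section \<open>Least constants are admissible\<close>

text \<open>For finite \<open>R x\<close> the condition on \<open>c\<close> is closed, so it
  survives the infimum. Finiteness matters: if \<open>R x\<close> were infinite, every positive
  \<open>c\<close> would be admissible, while \<open>c = 0\<close> would fail for positive
  \<open>L x\<close> because zero times infinity is zero in \<open>ennreal\<close>.\<close>

lemma Inf_best_constant:
  fixes L R :: "'x \<Rightarrow> ennreal"
  assumes S: "S = {c. 0 \<le> c \<and> (\<forall>x\<in>X. L x \<le> ennreal c * R x)}" and "S \<noteq> {}"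
    and fin: "\<And>x. x \<in> X \<Longrightarrow> R x < \<infinity>"
  shows "Inf S \<in> S"
proof -
  obtain c0 where c0: "c0 \<in> S" using \<open>S \<noteq> {}\<close> by blast
  have Inf0: "0 \<le> Inf S" using \<open>S \<noteq> {}\<close> by (intro cInf_greatest) (auto simp: S)
  have "L x \<le> ennreal (Inf S) * R x" if x: "x \<in> X" for x
  proof -
    obtain r where r: "R x = ennreal r" "0 \<le> r" using fin[OF x] by (cases "R x") auto
    have le: "L x \<le> ennreal (c * r)" if "c \<in> S" for c
      using that x r by (auto simp: S ennreal_mult)
    obtain l where l: "L x = ennreal l" "0 \<le> l" using le[OF c0] by (cases "L x") (auto simp: top_unique)
    have le': "l \<le> c * r" if "c \<in> S" for c
      using le[OF that] l r that by (simp add: S ennreal_le_iff)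
    have "l \<le> Inf S * r"
    proof (cases "r = 0")
      case False
      then have "l / r \<le> Inf S"
        using r le' \<open>S \<noteq> {}\<close> by (intro cInf_greatest) (auto simp: divide_le_eq)
      then show ?thesis using False r by (simp add: divide_le_eq)
    qed (use le'[OF c0] in simp)
    then show ?thesis using l r Inf0 by (simp add: ennreal_mult[symmetric] ennreal_leI)
  qed
  with Inf0 show ?thesis by (subst S) simp
qed

text \<open>Pairs \<open>(u, G)\<close> merge the two quantifiers into one index set; the right-hand
  side is finite because \<open>G\<close> is in \<open>L2 \<Omega>\<close>.\<close>

lemma hardy_inequality_constant:
  assumes "\<exists>H. hardy_inequality \<Omega> H"
  shows "hardy_inequality \<Omega> (hardy_constant \<Omega>)"
proof -
  have "Inf {H. hardy_inequality \<Omega> H} \<in> {H. hardy_inequality \<Omega> H}"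
    by (rule Inf_best_constant[where X="{(u, G). u \<in> H10 \<Omega> \<and> has_L2_gradient \<Omega> u G}"
        and L="\<lambda>(u, G). \<integral>\<^sup>+ x. ennreal ((norm (u x))\<^sup>2 / (bdist \<Omega> x)\<^sup>2) \<partial>lebesgue_on \<Omega>"
        and R="\<lambda>(u, G). l2_normsq \<Omega> G"])
      (use assms in \<open>auto simp: hardy_inequality_def has_L2_gradient_def L2_def\<close>)
  then show ?thesis by (simp add: hardy_constant_def)
qed

lemma friedrichs_velte2_best_constant:
  assumes "\<exists>\<Gamma>. friedrichs_velte2 \<Omega> \<Gamma>"
  shows "friedrichs_velte2 \<Omega> (friedrichs_velte2_constant \<Omega>)"
proof -
  have "Inf {\<Gamma>. friedrichs_velte2 \<Omega> \<Gamma>} \<in> {\<Gamma>. friedrichs_velte2 \<Omega> \<Gamma>}"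
    by (rule Inf_best_constant[where X="{(u, v). u \<in> L2 \<Omega> \<and> v \<in> ker_rot_perp \<Omega> \<and>
          distr_eq \<Omega> (distr_rot (distr \<Omega> v)) (distr_grad (distr \<Omega> u)) \<and>
          distr_eq \<Omega> (distr_div (distr \<Omega> v)) (\<lambda>_. 0)}"
        and L="\<lambda>(u, v). l2_normsq \<Omega> v" and R="\<lambda>(u, v). l2_normsq \<Omega> u"])
      (use assms in \<open>auto simp: friedrichs_velte2_def L2_def\<close>)
  then show ?thesis by (simp add: friedrichs_velte2_constant_def)
qed

lemma weighted_rot_inequality_constant:
  assumes "\<exists>P. weighted_rot_inequality \<Omega> P"
  shows "weighted_rot_inequality \<Omega> (weighted_rot_constant \<Omega>)"
proof -
  have "Inf {P. weighted_rot_inequality \<Omega> P} \<in> {P. weighted_rot_inequality \<Omega> P}"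
    by (rule Inf_best_constant[where X="{v \<in> ker_rot_perp \<Omega>. weighted_rot_normsq \<Omega> v < \<infinity>}"
        and L="l2_normsq \<Omega>" and R="weighted_rot_normsq \<Omega>"])
      (use assms in \<open>auto simp: weighted_rot_inequality_def\<close>)
  then show ?thesis by (simp add: weighted_rot_constant_def)
qed

theorem lemma3p8:
  fixes \<Omega> :: "(real ^ 3) set"
  assumes "bounded_domain \<Omega>"
    and "\<exists>H. hardy_inequality \<Omega> H"
    and "\<exists>\<Gamma>. friedrichs_velte2 \<Omega> \<Gamma>"
  shows "(\<exists>P>0. weighted_rot_inequality \<Omega> P) \<and>
    weighted_rot_inequality \<Omega> (weighted_rot_constant \<Omega>) \<and>
    weighted_rot_constant \<Omega> \<le> hardy_constant \<Omega> * (1 + friedrichs_velte2_constant \<Omega>)"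
proof -
  let ?P = "hardy_constant \<Omega> * (1 + friedrichs_velte2_constant \<Omega>)"
  have P: "weighted_rot_inequality \<Omega> ?P"
    by (intro weighted_rot_inequality_product hardy_inequality_constant friedrichs_velte2_best_constant assms)
  \<comment> \<open>\<open>?P\<close> is only known to be nonnegative, whereas a strictly positive
    constant is claimed.\<close>
  have "weighted_rot_inequality \<Omega> (?P + 1)"
    unfolding weighted_rot_inequality_def
  proof (intro conjI ballI impI)
    show "0 \<le> ?P + 1" using P by (simp add: weighted_rot_inequality_def)
    fix v assume "v \<in> ker_rot_perp \<Omega>" "weighted_rot_normsq \<Omega> v < \<infinity>"
    then have "l2_normsq \<Omega> v \<le> ennreal ?P * weighted_rot_normsq \<Omega> v"
      using P by (simp add: weighted_rot_inequality_def)
    also have "\<dots> \<le> ennreal (?P + 1) * weighted_rot_normsq \<Omega> v"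
      by (intro mult_right_mono ennreal_leI) auto
    finally show "l2_normsq \<Omega> v \<le> ennreal (?P + 1) * weighted_rot_normsq \<Omega> v" .
  qed
  moreover have "0 < ?P + 1" using P by (simp add: weighted_rot_inequality_def)
  moreover have "weighted_rot_constant \<Omega> \<le> ?P"
    unfolding weighted_rot_constant_def
    using P by (intro cInf_lower bdd_belowI[where m=0]) (auto simp: weighted_rot_inequality_def)
  ultimately show ?thesis using weighted_rot_inequality_constant[of \<Omega>] by blast
qed

end
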